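(* Let $\mathcal X,\mathcal Y$ be real Hilbert spaces, $f:\mathcal X\to(-\infty,+\infty]$ and $g:\mathcal Y\to(-\infty,+\infty]$ proper, convex and lower semicontinuous, and $A:\mathcal X\to\mathcal Y$ bounded linear. Let $\beta:[0,+\infty)\to(0,+\infty)$ be differentiable, $\beta_0=\beta(0)$, $\alpha_0,\delta_0>0$, and $$\alpha(t)=\frac{\alpha_0}{\beta_0}\beta(t)\exp\left(-\int_0^t\frac{ds}{\beta(s)}\right),\qquad \gamma=-\beta,\qquad \delta(t)=\frac{\delta_0}{\beta_0}\beta(t)\exp\left(-\int_0^t\frac{ds}{\beta(s)}\right).$$ Let $(x,y):[0,+\infty)\to\mathcal X\times\mathcal Y$ be a trajectory of $$\left\{\begin{array}{rcl}\alpha(t)\dot x(t)+\beta(t)A^*\dot y(t)+\partial f(x(t))+A^*y(t)&\ni&0\\ \gamma(t)A\dot x(t)+\delta(t)\dot y(t)-Ax(t)+\partial g^*(y(t))&\ni&0.\end{array}\right.$$ Fix $(u,v)\in\mathcal X\times\mathcal Y$ and $(\bar x,\bar y)\in\mathcal S$. Then the functions $\frac1\beta d_{\bar x,\bar y}$, $\alpha\|\dot x\|^2$ and $\delta\|\dot y\|^2$ belong to $L^1(0,+\infty)$, and for every $t\ge0$ $$\Delta_{u,v}(t)\le\mathcal E^A_{u,v}(0)\exp\left(-\int_0^t\frac{ds}{\beta(s)}\right),$$ $$f(x(t))-f(\bar x)+\langle A^*\bar y,x(t)-\bar x\rangle\le\mathcal E^A_{\bar x,\bar y}(0)\exp\left(-\int_0^t\frac{ds}{\beta(s)}\right),$$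 $$g^*(y(t))-g^*(\bar y)+\langle y(t)-\bar y,-A\bar x\rangle\le\mathcal E^A_{\bar x,\bar y}(0)\exp\left(-\int_0^t\frac{ds}{\beta(s)}\right).$$ Moreover, the trajectory is bounded, with $$\frac{\alpha_0}{2}\|x(t)-\bar x\|^2+\frac{\delta_0}{2}\|y(t)-\bar y\|^2\le\beta_0\,\mathcal E^A_{\bar x,\bar y}(0).$$ In particular, if $\int_0^\infty\frac{ds}{\beta(s)}=\infty$, then every weak subsequential limit point of $(x(t),y(t))$, as $t\to+\infty$, belongs to $\mathcal S$. If we further assume that $f$ is $\mu$-strongly convex ($\mu>0$), then $x(t)$ converges strongly, as $t\to+\infty$, to the unique $\bar x$, with $$\|x(t)-\bar x\|^2\le\frac2\mu\,\mathcal E^A_{\bar x,\bar y}(0)\exp\left(-\int_0^t\frac{ds}{\beta(s)}\right).$$ Similarly, if $g$ is $L$-smooth ($L>0$), then $$\|y(t)-\bar y\|^2\le2L\,\mathcal E^A_{\bar x,\bar y}(0)\exp\left(-\int_0^t\frac{ds}{\beta(s)}\right).$$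
   Context: $A^*$ is the adjoint of $A$, $\partial$ the convex subdifferential, $g^*$ the Fenchel conjugate of $g$. The underlying problem is $\min_{x\in\mathcal X}f(x)+g(Ax)$. A primal-dual solution is a pair $(\bar x,\bar y)\in\mathcal X\times\mathcal Y$ with $-A^*\bar y\in\partial f(\bar x)$ and $A\bar x\in\partial g^*(\bar y)$; $\mathcal S$ is the set of primal-dual solutions. A trajectory of the system is a pair of functions $x:[0,+\infty)\to\mathcal X$, $y:[0,+\infty)\to\mathcal Y$ that are locally absolutely continuous, such that $f\circ x$ and $g^*\circ y$ are (finite and) locally absolutely continuous on $[0,+\infty)$, and the system holds for almost every $t>0$. The Lagrangian is $\mathcal L(u,v)=f(u)+\langle v,Au\rangle-g^*(v)$. The duality gap along $(x,y)$ is $$\Delta_{u,v}(t)=\mathcal L(x(t),v)-\mathcal L(u,y(t))=[f(x(t))-f(u)+\langle A^*v,x(t)-u\rangle]+[g^*(y(t))-g^*(v)+\langle y(t)-v,-Au\rangle],$$ with value $-\infty$ if $f(u)=+\infty$ or $g^*(v)=+\infty$. The energy is $$\mathcal E^A_{u,v}(t)=\Delta_{u,v}(t)+\frac{\alpha(t)}{2\beta(t)}\|x(t)-u\|^2+\frac{\delta(t)}{2\beta(t)}\|y(t)-v\|^2.$$ With $X(t)=-\alpha(t)\dot x(t)-\beta(t)A^*\dot y(t)-A^*y(t)\in\partial f(x(t))$ and $Y(t)=-\gamma(t)A\dot x(t)-\delta(t)\dot y(t)+Ax(t)\in\partial g^*(y(t))$, the Bregman divergence is $$d_{u,v}(t)=[f(u)-f(x(t))-\langle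 X(t),u-x(t)\rangle]+[g^*(v)-g^*(y(t))-\langle Y(t),v-y(t)\rangle].$$ A weak subsequential limit point of $(x(t),y(t))$ as $t\to+\infty$ is a weak limit of $(x(t_k),y(t_k))$ for some sequence $t_k\to+\infty$. "$g$ is $L$-smooth" means $g$ is differentiable with $L$-Lipschitz gradient. *)

theory Defs
  imports "HOL-Analysis.Analysis"
begin

section \<open>Convex analysis for extended real valued functions\<close>

definition proper :: "('a \<Rightarrow> ereal) \<Rightarrow> bool" where
  "proper f \<longleftrightarrow> (\<forall>z. f z \<noteq> -\<infinity>) \<and> (\<exists>z. f z \<noteq> \<infinity>)"

definition ereal_convex :: "('a::real_vector \<Rightarrow> ereal) \<Rightarrow> bool" where
  "ereal_convex f \<longleftrightarrow>
     (\<forall>p q. \<forall>s\<in>{0<..<1}.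
        f ((1 - s) *\<^sub>R p + s *\<^sub>R q) \<le> ereal (1 - s) * f p + ereal s * f q)"

definition strongly_convex :: "real \<Rightarrow> ('a::real_normed_vector \<Rightarrow> ereal) \<Rightarrow> bool" where
  "strongly_convex \<mu> f \<longleftrightarrow>
     (\<forall>p q. \<forall>s\<in>{0<..<1}.
        f ((1 - s) *\<^sub>R p + s *\<^sub>R q) + ereal (\<mu> / 2 * s * (1 - s) * (norm (p - q))\<^sup>2)
          \<le> ereal (1 - s) * f p + ereal s * f q)"

definition lower_semicontinuous :: "('a::topological_space \<Rightarrow> ereal) \<Rightarrow> bool" where
  "lower_semicontinuous f \<longleftrightarrow> (\<forall>z. f z \<le> Liminf (nhds z) f)"

definition subdifferential :: "('a::real_inner \<Rightarrow> ereal) \<Rightarrow> 'a \<Rightarrow> 'a set" where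
  "subdifferential f z = {p. \<bar>f z\<bar> \<noteq> \<infinity> \<and> (\<forall>w. f z + ereal (p \<bullet> (w - z)) \<le> f w)}"

definition fenchel_conjugate :: "('a::real_inner \<Rightarrow> ereal) \<Rightarrow> 'a \<Rightarrow> ereal" where
  "fenchel_conjugate g p = (SUP z. ereal (p \<bullet> z) - g z)"

definition smooth_fun :: "real \<Rightarrow> ('a::real_inner \<Rightarrow> ereal) \<Rightarrow> bool" where
  "smooth_fun L g \<longleftrightarrow>
     (\<forall>z. \<bar>g z\<bar> \<noteq> \<infinity>) \<and>
     (\<exists>G. (\<forall>z. GDERIV (\<lambda>w. real_of_ereal (g w)) z :> G z) \<and> L-lipschitz_on UNIV G)"


section \<open>Absolute continuity, integrability and weak limits\<close>

definition abs_continuous_on_interval ::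
  "real \<Rightarrow> real \<Rightarrow> (real \<Rightarrow> 'a::real_normed_vector) \<Rightarrow> bool" where
  "abs_continuous_on_interval a b h \<longleftrightarrow>
     (\<forall>\<epsilon>>0. \<exists>\<eta>>0. \<forall>n. \<forall>l r :: nat \<Rightarrow> real.
        (\<forall>i<n. a \<le> l i \<and> l i \<le> r i \<and> r i \<le> b) \<longrightarrow>
        (\<forall>i<n. \<forall>j<n. i \<noteq> j \<longrightarrow> {l i<..<r i} \<inter> {l j<..<r j} = {}) \<longrightarrow>
        (\<Sum>i<n. r i - l i) < \<eta> \<longrightarrow>
        (\<Sum>i<n. norm (h (r i) - h (l i))) < \<epsilon>)"

definition locally_abs_continuous :: "(real \<Rightarrow> 'a::real_normed_vector) \<Rightarrow> bool" where
  "locally_abs_continuous h \<longleftrightarrow> (\<forall>T\<ge>0. abs_continuous_on_interval 0 T h)"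

text \<open>Membership in \<open>L\<^sup>1(0,\<infinity>)\<close>; finiteness is required separately because \<^const>\<open>real_of_ereal\<close>
  maps infinite values to 0.\<close>

definition ereal_integrable_half_line :: "(real \<Rightarrow> ereal) \<Rightarrow> bool" where
  "ereal_integrable_half_line h \<longleftrightarrow>
     (AE t in lebesgue. t > 0 \<longrightarrow> \<bar>h t\<bar> \<noteq> \<infinity>) \<and>
     set_integrable lebesgue {0<..} (\<lambda>t. real_of_ereal (h t))"

definition weakly_converges :: "(nat \<Rightarrow> 'a::real_inner) \<Rightarrow> 'a \<Rightarrow> bool" where
  "weakly_converges z w \<longleftrightarrow> (\<forall>h. (\<lambda>k. z k \<bullet> h) \<longlonglongrightarrow> w \<bullet> h)"

definition weak_subseq_limit :: "(real \<Rightarrow> 'a::real_inner) \<Rightarrow> 'a \<Rightarrow> bool" where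
  "weak_subseq_limit z w \<longleftrightarrow>
     (\<exists>\<tau>. filterlim \<tau> at_top sequentially \<and> weakly_converges (\<lambda>k. z (\<tau> k)) w)"


section \<open>The primal-dual problem and its dynamics\<close>

definition primal_dual_solutions ::
  "('a::real_inner \<Rightarrow> ereal) \<Rightarrow> ('b::real_inner \<Rightarrow> ereal) \<Rightarrow> ('a \<Rightarrow> 'b) \<Rightarrow> ('a \<times> 'b) set" where
  "primal_dual_solutions f g A =
     {(u, v). - adjoint A v \<in> subdifferential f u \<and> A u \<in> subdifferential (fenchel_conjugate g) v}"

text \<open>The derivatives of \<open>x\<close> and \<open>y\<close> exist almost everywhere since both functions are locally
  absolutely continuous with values in Hilbert spaces; their existence at \<open>t\<close> is part of what it
  means for the system to hold at \<open>t\<close>.\<close>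

definition trajectory ::
  "('a::real_inner \<Rightarrow> ereal) \<Rightarrow> ('b::real_inner \<Rightarrow> ereal) \<Rightarrow> ('a \<Rightarrow> 'b) \<Rightarrow>
   (real \<Rightarrow> real) \<Rightarrow> (real \<Rightarrow> real) \<Rightarrow> (real \<Rightarrow> real) \<Rightarrow> (real \<Rightarrow> real) \<Rightarrow>
   (real \<Rightarrow> 'a) \<Rightarrow> (real \<Rightarrow> 'b) \<Rightarrow> bool" where
  "trajectory f g A \<alpha> \<beta> \<gamma> \<delta> x y \<longleftrightarrow>
     locally_abs_continuous x \<and> locally_abs_continuous y \<and>
     (\<forall>t\<ge>0. \<bar>f (x t)\<bar> \<noteq> \<infinity> \<and> \<bar>fenchel_conjugate g (y t)\<bar> \<noteq> \<infinity>) \<and>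
     locally_abs_continuous (\<lambda>t. real_of_ereal (f (x t))) \<and>
     locally_abs_continuous (\<lambda>t. real_of_ereal (fenchel_conjugate g (y t))) \<and>
     (AE t in lebesgue. t > 0 \<longrightarrow>
        (\<exists>x' y'. (x has_vector_derivative x') (at t) \<and> (y has_vector_derivative y') (at t) \<and>
          (\<exists>p \<in> subdifferential f (x t).
             \<alpha> t *\<^sub>R x' + \<beta> t *\<^sub>R adjoint A y' + p + adjoint A (y t) = 0) \<and>
          (\<exists>q \<in> subdifferential (fenchel_conjugate g) (y t).
             \<gamma> t *\<^sub>R A x' + \<delta> t *\<^sub>R y' - A (x t) + q = 0)))"

definition lagrangian ::
  "('a::real_inner \<Rightarrow> ereal) \<Rightarrow> ('b::real_inner \<Rightarrow> ereal) \<Rightarrow> ('a \<Rightarrow> 'b) \<Rightarrow> 'a \<Rightarrow> 'b \<Rightarrow> ereal" where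
  "lagrangian f g A u v = f u + ereal (v \<bullet> A u) - fenchel_conjugate g v"

definition duality_gap ::
  "('a::real_inner \<Rightarrow> ereal) \<Rightarrow> ('b::real_inner \<Rightarrow> ereal) \<Rightarrow> ('a \<Rightarrow> 'b) \<Rightarrow>
   (real \<Rightarrow> 'a) \<Rightarrow> (real \<Rightarrow> 'b) \<Rightarrow> 'a \<Rightarrow> 'b \<Rightarrow> real \<Rightarrow> ereal" where
  "duality_gap f g A x y u v t = lagrangian f g A (x t) v - lagrangian f g A u (y t)"

text \<open>Along a trajectory \<open>f (x t)\<close> and \<open>g\<^sup>* (y t)\<close> are finite, so the arithmetic of \<^typ>\<open>ereal\<close>
  yields the intended convention for infinite \<open>f u\<close> or \<open>g\<^sup>* v\<close>.\<close>

lemma duality_gap_eq_MInfty: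
  assumes "\<bar>f (x t)\<bar> \<noteq> \<infinity>" "\<bar>fenchel_conjugate g (y t)\<bar> \<noteq> \<infinity>"
    and "f u \<noteq> -\<infinity>" "fenchel_conjugate g v \<noteq> -\<infinity>"
    and "f u = \<infinity> \<or> fenchel_conjugate g v = \<infinity>"
  shows "duality_gap f g A x y u v t = -\<infinity>"
  using assms unfolding duality_gap_def lagrangian_def
  by (cases "f (x t)"; cases "fenchel_conjugate g (y t)"; cases "f u";
      cases "fenchel_conjugate g v") auto

definition energy ::
  "('a::real_inner \<Rightarrow> ereal) \<Rightarrow> ('b::real_inner \<Rightarrow> ereal) \<Rightarrow> ('a \<Rightarrow> 'b) \<Rightarrow>
   (real \<Rightarrow> real) \<Rightarrow> (real \<Rightarrow> real) \<Rightarrow> (real \<Rightarrow> real) \<Rightarrow>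
   (real \<Rightarrow> 'a) \<Rightarrow> (real \<Rightarrow> 'b) \<Rightarrow> 'a \<Rightarrow> 'b \<Rightarrow> real \<Rightarrow> ereal" where
  "energy f g A \<alpha> \<beta> \<delta> x y u v t =
     duality_gap f g A x y u v t
     + ereal (\<alpha> t / (2 * \<beta> t) * (norm (x t - u))\<^sup>2)
     + ereal (\<delta> t / (2 * \<beta> t) * (norm (y t - v))\<^sup>2)"

definition primal_subgradient ::
  "('a::real_inner \<Rightarrow> 'b::real_inner) \<Rightarrow> (real \<Rightarrow> real) \<Rightarrow> (real \<Rightarrow> real) \<Rightarrow>
   (real \<Rightarrow> 'a) \<Rightarrow> (real \<Rightarrow> 'b) \<Rightarrow> real \<Rightarrow> 'a" where
  "primal_subgradient A \<alpha> \<beta> x y t =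
     - (\<alpha> t *\<^sub>R vector_derivative x (at t)) - \<beta> t *\<^sub>R adjoint A (vector_derivative y (at t))
     - adjoint A (y t)"

definition dual_subgradient ::
  "('a::real_inner \<Rightarrow> 'b::real_inner) \<Rightarrow> (real \<Rightarrow> real) \<Rightarrow> (real \<Rightarrow> real) \<Rightarrow>
   (real \<Rightarrow> 'a) \<Rightarrow> (real \<Rightarrow> 'b) \<Rightarrow> real \<Rightarrow> 'b" where
  "dual_subgradient A \<gamma> \<delta> x y t =
     - (\<gamma> t *\<^sub>R A (vector_derivative x (at t))) - \<delta> t *\<^sub>R vector_derivative y (at t) + A (x t)"

definition bregman ::
  "('a::real_inner \<Rightarrow> ereal) \<Rightarrow> ('b::real_inner \<Rightarrow> ereal) \<Rightarrow> ('a \<Rightarrow> 'b) \<Rightarrow>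
   (real \<Rightarrow> real) \<Rightarrow> (real \<Rightarrow> real) \<Rightarrow> (real \<Rightarrow> real) \<Rightarrow> (real \<Rightarrow> real) \<Rightarrow>
   (real \<Rightarrow> 'a) \<Rightarrow> (real \<Rightarrow> 'b) \<Rightarrow> 'a \<Rightarrow> 'b \<Rightarrow> real \<Rightarrow> ereal" where
  "bregman f g A \<alpha> \<beta> \<gamma> \<delta> x y u v t =
     (f u - f (x t) - ereal (primal_subgradient A \<alpha> \<beta> x y t \<bullet> (u - x t)))
     + (fenchel_conjugate g v - fenchel_conjugate g (y t)
        - ereal (dual_subgradient A \<gamma> \<delta> x y t \<bullet> (v - y t)))"

end

theory Submission
  imports Defs
begin

text \<open>
  Everything follows from the energy \<open>E = \<Delta> + D (\<alpha>0 / (2 \<beta>0) |x - u|\<^sup>2 + \<delta>0 / (2 \<beta>0) |y - v|\<^sup>2)\<close>,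
  where \<open>D = exp (- \<integral> 1 / \<beta>)\<close>. Differentiating along the flow and inserting the two inclusions, all
  mixed terms combine into the Bregman divergence \<open>d\<close>, and
    \<open>E' = - \<alpha> |x'|\<^sup>2 - \<delta> |y'|\<^sup>2 - d / \<beta> - E / \<beta>\<close>
  (\<open>real_energy_supporting\<close>). Since \<open>d \<ge> 0\<close> by the subgradient inequality, \<open>E / D\<close> is
  nonincreasing, that is, \<open>E(t) \<le> E(0) D(t)\<close> (\<open>real_energy_decay\<close>). At a solution \<open>(xb, yb)\<close>
  the gap \<open>\<Delta>\<close> is the sum of two nonnegative parts; hence all the stated rates, the bound on the
  trajectory, and, as \<open>E\<close> stays nonnegative, the integrability of the three dissipation terms.

  The composition \<open>f \<circ> x\<close> is differentiated in a one-sided sense. At almost every \<open>t\<close> the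
  subgradient inequality bounds \<open>f (x s)\<close> from below by a function that is differentiable at \<open>t\<close>
  and agrees with it there. An absolutely continuous function that is touched from below in this way
  with nonpositive slopes is nonincreasing (\<open>AC_nonincreasing\<close>), and the dissipation that the
  slopes exhibit is integrable by Fatou's lemma for left difference quotients
  (\<open>supporting_slope_integrable\<close>).

  If \<open>D\<close> tends to 0, then \<open>limsup \<Delta> \<le> 0\<close> for every \<open>(u, v)\<close>, and weak lower semicontinuity makes
  each weak limit point a saddle point of the Lagrangian (\<open>weak_limit_solution\<close>). Strong convexity
  of \<open>f\<close> improves the subgradient inequality at \<open>xb\<close> by a quadratic term, and \<open>L\<close>-smoothness of
  \<open>g\<close> does the same for the conjugate at \<open>yb\<close> (\<open>smooth_conjugate_subgradient\<close>), so that the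
  decay of the two parts of the gap controls the distances.
\<close>

section \<open>Projections and adjoints in Hilbert spaces\<close>

text \<open>The parallelogram identity for \<open>w - p\<close> and \<open>w - q\<close>, in the form that shows points of a convex
  set almost closest to \<open>w\<close> to be close to each other.\<close>

lemma midpoint_parallelogram:
  fixes w p q :: "'a::real_inner"
  shows "(norm (p - q))\<^sup>2 =
    2 * (norm (w - p))\<^sup>2 + 2 * (norm (w - q))\<^sup>2 - 4 * (norm (w - ((1/2) *\<^sub>R p + (1/2) *\<^sub>R q)))\<^sup>2"
  by (simp add: power2_norm_eq_inner inner_simps inner_commute algebra_simps)

text \<open>A sequence in \<open>C\<close> that minimises the distance to \<open>w\<close> is Cauchy: midpoints stay in the
  convex set \<open>C\<close>, so the last term of the parallelogram identity is at least four times the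
  squared distance from \<open>w\<close> to \<open>C\<close>. The limit is the closest point, and the obtuse angle
  condition characterises it.\<close>

lemma Hilbert_projection:
  fixes C :: "'a::{real_inner, complete_space} set"
  assumes "closed C" "convex C" "C \<noteq> {}"
  obtains p where "p \<in> C" "\<And>z. z \<in> C \<Longrightarrow> (w - p) \<bullet> (z - p) \<le> 0"
proof -
  define r where "r = Inf ((\<lambda>z. (norm (w - z))\<^sup>2) ` C)"
  have bdd: "bdd_below ((\<lambda>z. (norm (w - z))\<^sup>2) ` C)"
    by (rule bdd_belowI[of _ 0]) auto
  have r_le: "r \<le> (norm (w - z))\<^sup>2" if "z \<in> C" for z
    unfolding r_def by (rule cInf_lower[OF _ bdd]) (use that in auto)
  have "\<exists>z\<in>C. (norm (w - z))\<^sup>2 < r + e" if "e > 0" for e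
    using cInf_lessD[of "(\<lambda>z. (norm (w - z))\<^sup>2) ` C" "r + e"] assms(3) that
    unfolding r_def by auto
  then have "\<forall>n. \<exists>z. z \<in> C \<and> (norm (w - z))\<^sup>2 < r + 1 / real (Suc n)"
    by (simp add: Bex_def)
  then obtain c where c: "\<And>n. c n \<in> C" "\<And>n. (norm (w - c n))\<^sup>2 < r + 1 / real (Suc n)"
    by metis
  have gap: "(norm (c m - c n))\<^sup>2 \<le> 2 * (1 / real (Suc m)) + 2 * (1 / real (Suc n))" for m n
  proof -
    have "(1/2) *\<^sub>R c m + (1/2) *\<^sub>R c n \<in> C"
      using assms(2) c(1) by (intro convexD) auto
    from r_le[OF this] c(2)[of m] c(2)[of n] show ?thesis
      unfolding midpoint_parallelogram[of "c m" "c n" w] by linarith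
  qed
  have "Cauchy c"
  proof (rule metric_CauchyI)
    fix e :: real assume "e > 0"
    then have "e\<^sup>2 / 4 > 0" by simp
    then obtain M where M: "1 / real (Suc M) < e\<^sup>2 / 4"
      using nat_approx_posE by metis
    have "dist (c m) (c n) < e" if "m \<ge> M" "n \<ge> M" for m n
    proof -
      have "1 / real (Suc m) \<le> 1 / real (Suc M)" "1 / real (Suc n) \<le> 1 / real (Suc M)"
        using that by (simp_all add: frac_le)
      then have "(norm (c m - c n))\<^sup>2 < e\<^sup>2"
        using gap[of m n] M by linarith
      then show ?thesis
        using \<open>e > 0\<close> by (simp add: dist_norm power2_less_imp_less)
    qed
    then show "\<exists>M. \<forall>m\<ge>M. \<forall>n\<ge>M. dist (c m) (c n) < e" by blast
  qed
  then obtain p where p: "c \<longlonglongrightarrow> p"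
    using Cauchy_convergent_iff convergent_def by blast
  have "p \<in> C"
    using closed_sequentially[OF assms(1)] c(1) p by blast
  have "(\<lambda>n. r + 1 / real (Suc n)) \<longlonglongrightarrow> r + 0"
    by (intro tendsto_add tendsto_const LIMSEQ_Suc[OF lim_1_over_n])
  moreover have "(\<lambda>n. (norm (w - c n))\<^sup>2) \<longlonglongrightarrow> (norm (w - p))\<^sup>2"
    by (intro tendsto_intros p)
  ultimately have "(norm (w - p))\<^sup>2 \<le> r + 0"
    using c(2) by (intro LIMSEQ_le) (auto intro: less_imp_le)
  then have "dist w p \<le> dist w z" if "z \<in> C" for z
    using r_le[OF that] by (simp add: dist_norm power2_le_imp_le)
  then show thesis
    using that any_closest_point_dot[OF assms(2,1) \<open>p \<in> C\<close>] \<open>p \<in> C\<close> by blast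
qed

text \<open>A nonzero functional \<open>\<phi>\<close> is represented by a multiple of the point of \<open>{\<phi> = 1}\<close> closest to
  the origin, since that point is orthogonal to the kernel of \<open>\<phi>\<close>.\<close>

lemma Riesz_representation:
  fixes \<phi> :: "'a::{real_inner, complete_space} \<Rightarrow> real"
  assumes "bounded_linear \<phi>"
  obtains r where "\<And>z. \<phi> z = z \<bullet> r"
proof (cases "\<forall>z. \<phi> z = 0")
  case True
  then show thesis using that[of 0] by simp
next
  case False
  interpret bounded_linear \<phi> by fact
  from False obtain z0 where z0: "\<phi> z0 \<noteq> 0" by blast
  \<comment> \<open>The point of this hyperplane closest to 0 is normal to it.\<close>
  define C where "C = {z. \<phi> z = 1}"
  have "closed C"
    unfolding C_def by (intro closed_Collect_eq continuous_on continuous_on_id continuous_on_const)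
  moreover have "convex C"
    unfolding C_def convex_def by (auto simp: add scaleR)
  moreover have "(1 / \<phi> z0) *\<^sub>R z0 \<in> C"
    using z0 by (simp add: C_def scaleR)
  ultimately obtain p where p: "p \<in> C" "\<And>z. z \<in> C \<Longrightarrow> (0 - p) \<bullet> (z - p) \<le> 0"
    using Hilbert_projection[of C 0] by blast
  have orth: "p \<bullet> k = 0" if "\<phi> k = 0" for k
  proof -
    have "p + k \<in> C" "p - k \<in> C"
      using p(1) that by (simp_all add: C_def add diff)
    from p(2)[OF this(1)] p(2)[OF this(2)] show ?thesis by simp
  qed
  have "p \<noteq> 0"
    using p(1) zero by (auto simp: C_def)
  have "\<phi> z = z \<bullet> ((1 / (p \<bullet> p)) *\<^sub>R p)" for z
  proof -
    have "\<phi> (z - \<phi> z *\<^sub>R p) = 0"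
      using p(1) by (simp add: C_def diff scaleR)
    from orth[OF this] have "p \<bullet> z = \<phi> z * (p \<bullet> p)"
      by (simp add: inner_simps)
    with \<open>p \<noteq> 0\<close> show ?thesis by (simp add: inner_commute)
  qed
  then show thesis by (rule that)
qed

text \<open>The constant \<^const>\<open>adjoint\<close> is a choice of some map with this property; the Riesz
  representation of \<open>z \<mapsto> A z \<bullet> w\<close> supplies one between Hilbert spaces.\<close>

lemma inner_adjoint:
  fixes A :: "'a::{real_inner, complete_space} \<Rightarrow> 'b::real_inner"
  assumes "bounded_linear A"
  shows "z \<bullet> adjoint A w = A z \<bullet> w"
proof -
  have "\<exists>r. \<forall>z. A z \<bullet> w = z \<bullet> r" for w
    using Riesz_representation[OF bounded_linear_inner_left_comp[OF assms]] by metis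
  then obtain B where "\<forall>z w. A z \<bullet> w = z \<bullet> B w" by metis
  with adjoint_unique[of A B] show ?thesis by simp
qed

section \<open>Weak lower semicontinuity\<close>

text \<open>The hyperplane orthogonal to \<open>w - p\<close> through the projection \<open>p\<close> of \<open>w\<close> separates
  \<open>w\<close> from \<open>C\<close>, and weak convergence preserves the separating inequality.\<close>

lemma closed_convex_weakly_closed:
  fixes C :: "'a::{real_inner, complete_space} set"
  assumes C: "closed C" "convex C"
    and z: "weakly_converges z w" "\<forall>\<^sub>F k in sequentially. z k \<in> C"
  shows "w \<in> C"
proof -
  have "C \<noteq> {}"
    using z(2) eventually_sequentially by auto
  then obtain p where p: "p \<in> C" "\<And>c. c \<in> C \<Longrightarrow> (w - p) \<bullet> (c - p) \<le> 0"
    using Hilbert_projection[OF C] by blast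
  have "(\<lambda>k. z k \<bullet> (w - p)) \<longlonglongrightarrow> w \<bullet> (w - p)"
    using z(1) by (simp add: weakly_converges_def)
  then have "(\<lambda>k. z k \<bullet> (w - p) - p \<bullet> (w - p)) \<longlonglongrightarrow> w \<bullet> (w - p) - p \<bullet> (w - p)"
    by (rule tendsto_diff[OF _ tendsto_const])
  moreover have "\<forall>\<^sub>F k in sequentially. z k \<bullet> (w - p) - p \<bullet> (w - p) \<le> 0"
    using z(2)
  proof eventually_elim
    case (elim k)
    from p(2)[OF this] show ?case by (simp add: inner_simps inner_commute algebra_simps)
  qed
  ultimately have "w \<bullet> (w - p) - p \<bullet> (w - p) \<le> 0"
    by (intro tendsto_upperbound) auto
  then have "(w - p) \<bullet> (w - p) \<le> 0"
    by (simp only: inner_diff_left)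
  then have "w = p"
    using inner_gt_zero_iff[of "w - p"] by (meson eq_iff_diff_eq_0 not_less)
  then show ?thesis using p(1) by simp
qed

lemma closed_sublevel:
  assumes "lower_semicontinuous f"
  shows "closed {z. f z \<le> c}"
proof -
  have "open {z. c < f z}"
  proof (subst open_subopen, clarify)
    fix z assume "c < f z"
    also have "f z \<le> Liminf (nhds z) f"
      using assms by (simp add: lower_semicontinuous_def)
    finally have "\<forall>\<^sub>F w in nhds z. c < f w"
      by (rule less_LiminfD)
    then show "\<exists>T. open T \<and> z \<in> T \<and> T \<subseteq> {z. c < f z}"
      unfolding eventually_nhds by blast
  qed
  then show ?thesis
    by (simp add: closed_def Compl_eq not_le)
qed

lemma convex_sublevel:
  assumes "ereal_convex f"
  shows "convex {z. f z \<le> ereal c}"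
proof (rule convexI)
  fix p q and a b :: real
  assume pq: "p \<in> {z. f z \<le> ereal c}" "q \<in> {z. f z \<le> ereal c}" and ab: "0 \<le> a" "0 \<le> b" "a + b = 1"
  show "a *\<^sub>R p + b *\<^sub>R q \<in> {z. f z \<le> ereal c}"
  proof (cases "a = 0 \<or> b = 0")
    case True
    then show ?thesis using pq ab by auto
  next
    case False
    then have "b \<in> {0<..<1}" and a: "a = 1 - b" using ab by auto
    then have "f (a *\<^sub>R p + b *\<^sub>R q) \<le> ereal a * f p + ereal b * f q"
      using assms unfolding ereal_convex_def a by blast
    also have "\<dots> \<le> ereal a * ereal c + ereal b * ereal c"
      using pq ab by (intro add_mono ereal_mult_left_mono) auto
    also have "\<dots> = ereal c"
      using a by (simp add: left_diff_distrib)
    finally show ?thesis by simp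
  qed
qed

text \<open>The sublevel sets of \<open>f\<close> are closed and convex, hence weakly sequentially closed.\<close>

lemma weak_lsc:
  fixes f :: "'a::{real_inner, complete_space} \<Rightarrow> ereal"
  assumes f: "ereal_convex f" "lower_semicontinuous f"
    and z: "weakly_converges z w"
    and bound: "\<forall>\<^sub>F k in sequentially. f (z k) \<le> ereal (r k)" "r \<longlonglongrightarrow> c"
  shows "f w \<le> ereal c"
proof (rule ereal_le_epsilon2)
  fix e :: real assume "0 < e"
  then have "\<forall>\<^sub>F k in sequentially. r k < c + e"
    using bound(2) by (intro order_tendstoD) auto
  with bound(1) have "\<forall>\<^sub>F k in sequentially. z k \<in> {z. f z \<le> ereal (c + e)}"
  proof eventually_elim
    case (elim k)
    have "f (z k) \<le> ereal (r k)" by (rule elim)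
    also have "\<dots> \<le> ereal (c + e)" using elim by simp
    finally show ?case by simp
  qed
  from closed_convex_weakly_closed[OF closed_sublevel[OF f(2)] convex_sublevel[OF f(1)] z this]
  show "f w \<le> ereal c + ereal e" by simp
qed

text \<open>A conjugate is a supremum of weakly continuous affine functions.\<close>

lemma weak_lsc_conjugate:
  assumes z: "weakly_converges z w"
    and bound: "\<forall>\<^sub>F k in sequentially. fenchel_conjugate g (z k) \<le> ereal (r k)" "r \<longlonglongrightarrow> c"
  shows "fenchel_conjugate g w \<le> ereal c"
  unfolding fenchel_conjugate_def
proof (rule SUP_least)
  fix q
  have le: "\<forall>\<^sub>F k in sequentially. ereal (z k \<bullet> q) - g q \<le> ereal (r k)"
    using bound(1)
  proof eventually_elim
    case (elim k)
    have "ereal (z k \<bullet> q) - g q \<le> fenchel_conjugate g (z k)"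
      unfolding fenchel_conjugate_def by (rule SUP_upper) simp
    then show ?case using elim by (rule order_trans)
  qed
  show "ereal (w \<bullet> q) - g q \<le> ereal c"
  proof (cases "g q")
    case (real a)
    have "w \<bullet> q - a \<le> c"
    proof (rule tendsto_le[OF _ bound(2)])
      show "(\<lambda>k. z k \<bullet> q - a) \<longlonglongrightarrow> w \<bullet> q - a"
        using z by (intro tendsto_diff[OF _ tendsto_const]) (simp add: weakly_converges_def)
      show "\<forall>\<^sub>F k in sequentially. z k \<bullet> q - a \<le> r k"
        using le real by simp
    qed simp
    then show ?thesis using real by simp
  next
    case PInf
    then show ?thesis by simp
  next
    case MInf
    then have "\<forall>\<^sub>F k in sequentially. False" using le by simp
    then show ?thesis by simp
  qed
qed

section \<open>Strong convexity, smoothness and subgradients\<close>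

lemma subdifferentialD:
  assumes "p \<in> subdifferential f z"
  shows "\<bar>f z\<bar> \<noteq> \<infinity>" "f z + ereal (p \<bullet> (w - z)) \<le> f w"
  using assms by (auto simp: subdifferential_def)

lemma subdifferential_real:
  assumes "p \<in> subdifferential f z" "\<bar>f w\<bar> \<noteq> \<infinity>"
  shows "real_of_ereal (f z) + p \<bullet> (w - z) \<le> real_of_ereal (f w)"
proof -
  have "f z = ereal (real_of_ereal (f z))" "f w = ereal (real_of_ereal (f w))"
    using assms subdifferentialD(1)[OF assms(1)] by (simp_all add: ereal_real)
  with subdifferentialD(2)[OF assms(1), of w] show ?thesis
    by (metis ereal_less_eq(3) plus_ereal.simps(1))
qed

text \<open>The quadratic term is recovered by moving from \<open>z\<close> a fraction \<open>s\<close> of the way towards \<open>w\<close>,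
  dividing by \<open>s\<close>, and letting \<open>s\<close> tend to 0.\<close>

lemma strongly_convex_subgradient:
  assumes f: "strongly_convex \<mu> f" and p: "p \<in> subdifferential f z" and w: "\<bar>f w\<bar> \<noteq> \<infinity>"
  shows "real_of_ereal (f z) + p \<bullet> (w - z) + \<mu> / 2 * (norm (w - z))\<^sup>2 \<le> real_of_ereal (f w)"
proof -
  define a b where "a = real_of_ereal (f z)" and "b = real_of_ereal (f w)"
  have ab: "f z = ereal a" "f w = ereal b"
    using w subdifferentialD(1)[OF p] by (simp_all add: ereal_real a_def b_def)
  have ineq: "p \<bullet> (w - z) + \<mu> / 2 * (1 - s) * (norm (z - w))\<^sup>2 \<le> b - a" if s: "0 < s" "s < 1" for s
  proof -
    define m where "m = (1 - s) *\<^sub>R z + s *\<^sub>R w"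
    have "ereal (a + p \<bullet> (m - z)) \<le> f m"
      using subdifferentialD(2)[OF p, of m] ab by simp
    then have "ereal (a + p \<bullet> (m - z)) + ereal (\<mu> / 2 * s * (1 - s) * (norm (z - w))\<^sup>2)
        \<le> f m + ereal (\<mu> / 2 * s * (1 - s) * (norm (z - w))\<^sup>2)"
      by (rule add_right_mono)
    also have "\<dots> \<le> ereal (1 - s) * f z + ereal s * f w"
      using f s unfolding strongly_convex_def m_def by auto
    finally have "a + p \<bullet> (m - z) + \<mu> / 2 * s * (1 - s) * (norm (z - w))\<^sup>2 \<le> (1 - s) * a + s * b"
      using ab by simp
    moreover have "m - z = s *\<^sub>R (w - z)"
      by (simp add: m_def algebra_simps)
    ultimately have "s * (p \<bullet> (w - z) + \<mu> / 2 * (1 - s) * (norm (z - w))\<^sup>2) \<le> s * (b - a)"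
      by (simp add: algebra_simps)
    then show ?thesis using s by (simp add: mult_le_cancel_left_pos)
  qed
  have "((\<lambda>s. p \<bullet> (w - z) + \<mu> / 2 * (1 - s) * (norm (z - w))\<^sup>2) \<longlongrightarrow>
      p \<bullet> (w - z) + \<mu> / 2 * (1 - 0) * (norm (z - w))\<^sup>2) (at_right 0)"
    by (intro tendsto_intros)
  moreover have "\<forall>\<^sub>F s in at_right 0. p \<bullet> (w - z) + \<mu> / 2 * (1 - s) * (norm (z - w))\<^sup>2 \<le> b - a"
    using eventually_at_right_real[OF zero_less_one] by eventually_elim (rule ineq, auto)
  ultimately have "p \<bullet> (w - z) + \<mu> / 2 * (1 - 0) * (norm (z - w))\<^sup>2 \<le> b - a"
    by (intro tendsto_upperbound) auto
  then show ?thesis by (simp add: a_def b_def norm_minus_commute)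
qed

lemma GDERIV_along_line:
  assumes "GDERIV h (p + t *\<^sub>R d) :> G"
  shows "((\<lambda>s. h (p + s *\<^sub>R d)) has_real_derivative d \<bullet> G) (at t)"
proof -
  have "((\<lambda>s. p + s *\<^sub>R d) has_derivative (\<lambda>s. s *\<^sub>R d)) (at t)"
    by (auto intro!: derivative_eq_intros)
  from has_derivative_compose[OF this assms[unfolded gderiv_def]] show ?thesis
    by (simp add: has_field_derivative_def mult.commute[of _ "d \<bullet> G"] mult_commute_abs)
qed

text \<open>Smoothness of \<open>g\<close> turns into a quadratic lower bound for the conjugate. Testing the
  subgradient inequality of the conjugate at the gradient \<open>G p\<close> shows that \<open>p\<close> and \<open>z\<close>
  attain equality in the Fenchel-Young inequality. Hence \<open>z\<close> is the gradient of \<open>g\<close> at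
  \<open>p\<close>, the descent lemma bounds \<open>g\<close> from above by a quadratic around \<open>p\<close>, and evaluating
  the supremum that defines the conjugate at \<open>p + (w - z) / L\<close>, where this quadratic bound is
  best, gives the claim.\<close>

lemma smooth_conjugate_subgradient:
  fixes g :: "'a::real_inner \<Rightarrow> ereal"
  assumes conv: "ereal_convex g" and smooth: "smooth_fun L g" and L: "L > 0"
    and p: "p \<in> subdifferential (fenchel_conjugate g) z" and w: "\<bar>fenchel_conjugate g w\<bar> \<noteq> \<infinity>"
  shows "real_of_ereal (fenchel_conjugate g z) + p \<bullet> (w - z) + 1 / (2 * L) * (norm (w - z))\<^sup>2
    \<le> real_of_ereal (fenchel_conjugate g w)"
proof -
  define h where "h = (\<lambda>q. real_of_ereal (g q))"
  have gh: "g q = ereal (h q)" for q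
    using smooth by (simp add: smooth_fun_def h_def ereal_real)
  from smooth obtain G where G: "\<And>q. GDERIV h q :> G q" and lip: "L-lipschitz_on UNIV G"
    by (auto simp: smooth_fun_def h_def)
  have grad_ineq: "h q + (r - q) \<bullet> G q \<le> h r" for q r
  proof -
    have "((\<lambda>s. h (q + s *\<^sub>R (r - q))) has_real_derivative (r - q) \<bullet> G q) (at 0)"
      using GDERIV_along_line[of h q 0 "r - q" "G q"] G by simp
    then have "((\<lambda>s. (h (q + s *\<^sub>R (r - q)) - h q) / s) \<longlongrightarrow> (r - q) \<bullet> G q) (at_right 0)"
      by (auto simp: has_field_derivative_iff intro: tendsto_mono[OF at_le])
    moreover have "(h (q + s *\<^sub>R (r - q)) - h q) / s \<le> h r - h q" if "0 < s" "s < 1" for s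
    proof -
      have "q + s *\<^sub>R (r - q) = (1 - s) *\<^sub>R q + s *\<^sub>R r" by (simp add: algebra_simps)
      moreover have "g ((1 - s) *\<^sub>R q + s *\<^sub>R r) \<le> ereal (1 - s) * g q + ereal s * g r"
        using conv that by (auto simp: ereal_convex_def)
      ultimately have "h (q + s *\<^sub>R (r - q)) \<le> (1 - s) * h q + s * h r"
        by (simp add: gh)
      then show ?thesis using that by (simp add: field_simps)
    qed
    then have "\<forall>\<^sub>F s in at_right 0. (h (q + s *\<^sub>R (r - q)) - h q) / s \<le> h r - h q"
      using eventually_at_right_real[OF zero_less_one] by (auto elim!: eventually_mono)
    ultimately have "(r - q) \<bullet> G q \<le> h r - h q"
      by (intro tendsto_upperbound) auto
    then show ?thesis by simp
  qed
  have upper: "ereal (a \<bullet> q - h q) \<le> fenchel_conjugate g a" for a q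
    unfolding fenchel_conjugate_def by (rule SUP_upper2[of q]) (auto simp: gh)
  obtain c where c: "fenchel_conjugate g z = ereal c"
    using subdifferentialD(1)[OF p] by (cases "fenchel_conjugate g z") auto
  obtain c' where c': "fenchel_conjugate g w = ereal c'"
    using w by (cases "fenchel_conjugate g w") auto
  have conj_grad: "fenchel_conjugate g (G p) \<le> ereal (G p \<bullet> p - h p)"
    unfolding fenchel_conjugate_def
  proof (rule SUP_least)
    fix q
    show "ereal (G p \<bullet> q) - g q \<le> ereal (G p \<bullet> p - h p)"
      using grad_ineq[of p q] by (simp add: gh inner_simps inner_commute)
  qed
  have "ereal (c + p \<bullet> (G p - z)) \<le> ereal (G p \<bullet> p - h p)"
    using subdifferentialD(2)[OF p, of "G p"] conj_grad c by (metis order_trans plus_ereal.simps(1))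
  then have "c \<le> p \<bullet> z - h p"
    by (simp add: inner_simps inner_commute)
  moreover have "z \<bullet> p - h p \<le> c"
    using upper[of z p] c by simp
  ultimately have fy: "c = z \<bullet> p - h p"
    by (simp add: inner_commute)
  have sub: "h p + z \<bullet> (q - p) \<le> h q" for q
    using upper[of z q] c fy by (simp add: inner_simps)
  have grad: "G p = z"
  proof -
    define e where "e = G p - z"
    have "((\<lambda>s. h (p + s *\<^sub>R e) - s * (z \<bullet> e)) has_real_derivative e \<bullet> G p - z \<bullet> e) (at 0)"
      using GDERIV_along_line[of h p 0 e "G p"] G by (auto intro!: derivative_eq_intros)
    then have "e \<bullet> G p - z \<bullet> e = 0"
    proof (rule DERIV_local_min[OF _ zero_less_one], intro allI impI)
      fix s
      show "h (p + 0 *\<^sub>R e) - 0 * (z \<bullet> e) \<le> h (p + s *\<^sub>R e) - s * (z \<bullet> e)"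
        using sub[of "p + s *\<^sub>R e"] by simp
    qed
    then have "e \<bullet> e = 0"
      by (simp add: e_def inner_simps inner_commute)
    then show ?thesis by (simp add: e_def)
  qed
  have descent: "h (p + e) \<le> h p + z \<bullet> e + L / 2 * (norm e)\<^sup>2" for e
  proof -
    define k where "k = (\<lambda>t. h (p + t *\<^sub>R e) - t * (z \<bullet> e) - L * t\<^sup>2 / 2 * (norm e)\<^sup>2)"
    have "k 1 \<le> k 0"
    proof (rule DERIV_nonpos_imp_nonincreasing[of 0 1 k])
      fix t :: real assume t: "0 \<le> t" "t \<le> 1"
      have "(k has_real_derivative e \<bullet> G (p + t *\<^sub>R e) - z \<bullet> e - L * t * (norm e)\<^sup>2) (at t)"
        unfolding k_def using GDERIV_along_line[OF G]
        by (auto intro!: derivative_eq_intros)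
      moreover have "e \<bullet> G (p + t *\<^sub>R e) - z \<bullet> e - L * t * (norm e)\<^sup>2 \<le> 0"
      proof -
        have "e \<bullet> (G (p + t *\<^sub>R e) - G p) \<le> norm e * norm (G (p + t *\<^sub>R e) - G p)"
          by (rule norm_cauchy_schwarz)
        also have "\<dots> \<le> norm e * (L * norm ((p + t *\<^sub>R e) - p))"
          using lipschitz_onD[OF lip, of "p + t *\<^sub>R e" p]
          by (intro mult_left_mono) (auto simp: dist_norm)
        also have "\<dots> = L * t * (norm e)\<^sup>2"
          using t by (simp add: power2_eq_square)
        finally show ?thesis by (simp add: grad inner_simps inner_commute)
      qed
      ultimately show "\<exists>y. (k has_real_derivative y) (at t) \<and> y \<le> 0" by blast
    qed simp
    then show ?thesis by (simp add: k_def algebra_simps)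
  qed
  \<comment> \<open>The maximiser of \<open>(w - z) \<bullet> e - L / 2 |e|\<^sup>2\<close>.\<close>
  define e where "e = (1 / L) *\<^sub>R (w - z)"
  have we: "(w - z) \<bullet> e = 1 / L * (norm (w - z))\<^sup>2" and ne: "(norm e)\<^sup>2 = 1 / L\<^sup>2 * (norm (w - z))\<^sup>2"
    by (simp_all add: e_def power_mult_distrib power_divide flip: power2_norm_eq_inner)
  have "w \<bullet> (p + e) - h (p + e) \<le> c'"
    using upper[of w "p + e"] c' by simp
  with descent[of e] have "w \<bullet> p - h p + ((w - z) \<bullet> e - L / 2 * (norm e)\<^sup>2) \<le> c'"
    by (simp add: inner_simps)
  moreover have "(w - z) \<bullet> e - L / 2 * (norm e)\<^sup>2 = 1 / (2 * L) * (norm (w - z))\<^sup>2"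
    unfolding we ne using L by (simp add: field_simps power2_eq_square)
  ultimately show ?thesis
    using fy c c' by (simp add: inner_simps inner_commute)
qed

section \<open>Absolutely continuous functions\<close>

lemma AC_modulus:
  assumes "abs_continuous_on_interval a b h" "e > 0"
  obtains \<eta> where "\<eta> > 0" "\<And>(n::nat) l r. (\<forall>i<n. a \<le> l i \<and> l i \<le> r i \<and> r i \<le> b) \<Longrightarrow>
      (\<forall>i<n. \<forall>j<n. i \<noteq> j \<longrightarrow> {l i<..<r i} \<inter> {l j<..<r j} = {}) \<Longrightarrow>
      (\<Sum>i<n. r i - l i) < \<eta> \<Longrightarrow> (\<Sum>i<n. norm (h (r i) - h (l i))) < e"
proof -
  from assms(1)[unfolded abs_continuous_on_interval_def, rule_format, OF assms(2)]
  obtain \<eta> where \<eta>: "\<eta> > 0" "\<forall>n. \<forall>l r :: nat \<Rightarrow> real.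
        (\<forall>i<n. a \<le> l i \<and> l i \<le> r i \<and> r i \<le> b) \<longrightarrow>
        (\<forall>i<n. \<forall>j<n. i \<noteq> j \<longrightarrow> {l i<..<r i} \<inter> {l j<..<r j} = {}) \<longrightarrow>
        (\<Sum>i<n. r i - l i) < \<eta> \<longrightarrow>
        (\<Sum>i<n. norm (h (r i) - h (l i))) < e"
    by (elim exE conjE)
  show thesis by (rule that[OF \<eta>(1)]) (use \<eta>(2) in blast)
qed

text \<open>Absolute continuity passes to every function whose increments are controlled by those of
  absolutely continuous functions. Sums, bilinear products and Lipschitz functions are all covered
  by this one principle.\<close>

lemma AC_dominated:
  assumes f: "abs_continuous_on_interval a b f" and g: "abs_continuous_on_interval a b g"
    and dom: "\<And>s t. a \<le> s \<Longrightarrow> s \<le> t \<Longrightarrow> t \<le> b \<Longrightarrow>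
      norm (h t - h s) \<le> K * (norm (f t - f s) + norm (g t - g s))"
  shows "abs_continuous_on_interval a b h"
  unfolding abs_continuous_on_interval_def
proof (intro allI impI)
  fix \<epsilon> :: real assume "\<epsilon> > 0"
  define K' where "K' = \<bar>K\<bar> + 1"
  have K': "K' > 0" "K \<le> K'" by (auto simp: K'_def)
  define e where "e = \<epsilon> / (2 * K')"
  have "e > 0" using \<open>\<epsilon> > 0\<close> K' by (simp add: e_def)
  obtain \<eta>f where \<eta>f: "\<eta>f > 0" "\<And>(n::nat) l r. (\<forall>i<n. a \<le> l i \<and> l i \<le> r i \<and> r i \<le> b) \<Longrightarrow>
      (\<forall>i<n. \<forall>j<n. i \<noteq> j \<longrightarrow> {l i<..<r i} \<inter> {l j<..<r j} = {}) \<Longrightarrow>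
      (\<Sum>i<n. r i - l i) < \<eta>f \<Longrightarrow> (\<Sum>i<n. norm (f (r i) - f (l i))) < e"
    by (rule AC_modulus[OF f \<open>e > 0\<close>]) (rule that; assumption)
  obtain \<eta>g where \<eta>g: "\<eta>g > 0" "\<And>(n::nat) l r. (\<forall>i<n. a \<le> l i \<and> l i \<le> r i \<and> r i \<le> b) \<Longrightarrow>
      (\<forall>i<n. \<forall>j<n. i \<noteq> j \<longrightarrow> {l i<..<r i} \<inter> {l j<..<r j} = {}) \<Longrightarrow>
      (\<Sum>i<n. r i - l i) < \<eta>g \<Longrightarrow> (\<Sum>i<n. norm (g (r i) - g (l i))) < e"
    by (rule AC_modulus[OF g \<open>e > 0\<close>]) (rule that; assumption)
  show "\<exists>\<eta>>0. \<forall>n. \<forall>l r :: nat \<Rightarrow> real.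
        (\<forall>i<n. a \<le> l i \<and> l i \<le> r i \<and> r i \<le> b) \<longrightarrow>
        (\<forall>i<n. \<forall>j<n. i \<noteq> j \<longrightarrow> {l i<..<r i} \<inter> {l j<..<r j} = {}) \<longrightarrow>
        (\<Sum>i<n. r i - l i) < \<eta> \<longrightarrow>
        (\<Sum>i<n. norm (h (r i) - h (l i))) < \<epsilon>"
  proof (intro exI[of _ "min \<eta>f \<eta>g"] conjI allI impI)
    fix n :: nat and l r :: "nat \<Rightarrow> real"
    assume lr: "\<forall>i<n. a \<le> l i \<and> l i \<le> r i \<and> r i \<le> b"
      "\<forall>i<n. \<forall>j<n. i \<noteq> j \<longrightarrow> {l i<..<r i} \<inter> {l j<..<r j} = {}"
      "(\<Sum>i<n. r i - l i) < min \<eta>f \<eta>g"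
    have "(\<Sum>i<n. norm (h (r i) - h (l i)))
        \<le> (\<Sum>i<n. K' * (norm (f (r i) - f (l i)) + norm (g (r i) - g (l i))))"
    proof (rule sum_mono)
      fix i assume "i \<in> {..<n}"
      then have "norm (h (r i) - h (l i)) \<le> K * (norm (f (r i) - f (l i)) + norm (g (r i) - g (l i)))"
        using lr(1) by (intro dom) auto
      also have "\<dots> \<le> K' * (norm (f (r i) - f (l i)) + norm (g (r i) - g (l i)))"
        using K' by (intro mult_right_mono) auto
      finally show "norm (h (r i) - h (l i)) \<le> \<dots>" .
    qed
    also have "\<dots> = K' * ((\<Sum>i<n. norm (f (r i) - f (l i))) + (\<Sum>i<n. norm (g (r i) - g (l i))))"
      by (simp add: sum_distrib_left sum.distrib distrib_left)
    also have "\<dots> < K' * (e + e)"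
      using \<eta>f(2)[OF lr(1,2)] \<eta>g(2)[OF lr(1,2)] lr(3) K'
      by (intro mult_strict_left_mono add_strict_mono) auto
    also have "\<dots> = \<epsilon>" using K' by (simp add: e_def)
    finally show "(\<Sum>i<n. norm (h (r i) - h (l i))) < \<epsilon>" .
  qed (use \<eta>f \<eta>g in auto)
qed

lemma AC_subinterval:
  assumes "abs_continuous_on_interval a b h" "a \<le> c" "d \<le> b"
  shows "abs_continuous_on_interval c d h"
  unfolding abs_continuous_on_interval_def
proof (intro allI impI)
  fix e :: real assume "e > 0"
  obtain \<eta> where \<eta>: "\<eta> > 0" "\<And>(n::nat) l r. (\<forall>i<n. a \<le> l i \<and> l i \<le> r i \<and> r i \<le> b) \<Longrightarrow>
      (\<forall>i<n. \<forall>j<n. i \<noteq> j \<longrightarrow> {l i<..<r i} \<inter> {l j<..<r j} = {}) \<Longrightarrow>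
      (\<Sum>i<n. r i - l i) < \<eta> \<Longrightarrow> (\<Sum>i<n. norm (h (r i) - h (l i))) < e"
    by (rule AC_modulus[OF assms(1) \<open>e > 0\<close>]) (rule that; assumption)
  show "\<exists>\<eta>>0. \<forall>n. \<forall>l r :: nat \<Rightarrow> real.
        (\<forall>i<n. c \<le> l i \<and> l i \<le> r i \<and> r i \<le> d) \<longrightarrow>
        (\<forall>i<n. \<forall>j<n. i \<noteq> j \<longrightarrow> {l i<..<r i} \<inter> {l j<..<r j} = {}) \<longrightarrow>
        (\<Sum>i<n. r i - l i) < \<eta> \<longrightarrow>
        (\<Sum>i<n. norm (h (r i) - h (l i))) < e"
  proof (intro exI[of _ \<eta>] conjI allI impI \<eta>)
    fix n :: nat and l r :: "nat \<Rightarrow> real" and i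
    assume "\<forall>i<n. c \<le> l i \<and> l i \<le> r i \<and> r i \<le> d" "i < n"
    then have "c \<le> l i" "l i \<le> r i" "r i \<le> d" by auto
    with assms(2,3) show "a \<le> l i" "l i \<le> r i" "r i \<le> b" by linarith+
  qed auto
qed

lemma AC_id: "abs_continuous_on_interval a b (\<lambda>t. t)"
  unfolding abs_continuous_on_interval_def
proof (intro allI impI)
  fix \<epsilon> :: real assume "\<epsilon> > 0"
  moreover have "(\<Sum>i<n. norm (r i - l i)) = (\<Sum>i<n. r i - l i)"
    if "\<forall>i<n. a \<le> l i \<and> l i \<le> r i \<and> r i \<le> b" for n and l r :: "nat \<Rightarrow> real"
    using that by (intro sum.cong) auto
  ultimately show "\<exists>\<eta>>0. \<forall>n. \<forall>l r :: nat \<Rightarrow> real.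
        (\<forall>i<n. a \<le> l i \<and> l i \<le> r i \<and> r i \<le> b) \<longrightarrow>
        (\<forall>i<n. \<forall>j<n. i \<noteq> j \<longrightarrow> {l i<..<r i} \<inter> {l j<..<r j} = {}) \<longrightarrow>
        (\<Sum>i<n. r i - l i) < \<eta> \<longrightarrow> (\<Sum>i<n. norm (r i - l i)) < \<epsilon>"
    by (intro exI[of _ \<epsilon>]) auto
qed

lemma AC_Lipschitz:
  assumes "\<And>s t. a \<le> s \<Longrightarrow> s \<le> t \<Longrightarrow> t \<le> b \<Longrightarrow> norm (h t - h s) \<le> K * (t - s)"
  shows "abs_continuous_on_interval a b h"
proof (rule AC_dominated[OF AC_id AC_id, where K = "K / 2"])
  fix s t assume "a \<le> s" "s \<le> t" "t \<le> b"
  then show "norm (h t - h s) \<le> K / 2 * (norm (t - s) + norm (t - s))"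
    using assms[of s t] by (simp add: field_simps)
qed

lemma AC_C1:
  fixes h :: "real \<Rightarrow> real"
  assumes deriv: "\<And>t. t \<in> {a..b} \<Longrightarrow> (h has_real_derivative h' t) (at t within {a..b})"
    and cont: "continuous_on {a..b} h'"
  shows "abs_continuous_on_interval a b h"
proof -
  have "bounded (h' ` {a..b})"
    by (intro compact_imp_bounded compact_continuous_image cont) auto
  then obtain K where K: "\<And>t. t \<in> {a..b} \<Longrightarrow> norm (h' t) \<le> K"
    unfolding bounded_iff by blast
  show ?thesis
  proof (rule AC_Lipschitz[where K = K])
    fix s t assume "a \<le> s" "s \<le> t" "t \<le> b"
    then show "norm (h t - h s) \<le> K * (t - s)"
      using field_differentiable_bound[of "{a..b}" h h' K t s] deriv K by auto
  qed
qed

lemma AC_continuous_on: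
  assumes "abs_continuous_on_interval a b h"
  shows "continuous_on {a..b} h"
  unfolding continuous_on_iff
proof (intro ballI allI impI)
  fix t and e :: real assume t: "t \<in> {a..b}" and "e > 0"
  obtain \<eta> where \<eta>: "\<eta> > 0" "\<And>(n::nat) l r. (\<forall>i<n. a \<le> l i \<and> l i \<le> r i \<and> r i \<le> b) \<Longrightarrow>
      (\<forall>i<n. \<forall>j<n. i \<noteq> j \<longrightarrow> {l i<..<r i} \<inter> {l j<..<r j} = {}) \<Longrightarrow>
      (\<Sum>i<n. r i - l i) < \<eta> \<Longrightarrow> (\<Sum>i<n. norm (h (r i) - h (l i))) < e"
    by (rule AC_modulus[OF assms \<open>e > 0\<close>]) (rule that; assumption)
  have "dist (h s) (h t) < e" if "s \<in> {a..b}" "dist s t < \<eta>" for s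
    using \<eta>(2)[of "Suc 0" "\<lambda>_. min s t" "\<lambda>_. max s t"] t that
    by (cases "s \<le> t") (auto simp: dist_norm min_def max_def norm_minus_commute)
  with \<eta>(1) show "\<exists>d>0. \<forall>s\<in>{a..b}. dist s t < d \<longrightarrow> dist (h s) (h t) < e"
    by blast
qed

lemma AC_add:
  assumes "abs_continuous_on_interval a b f" "abs_continuous_on_interval a b g"
  shows "abs_continuous_on_interval a b (\<lambda>t. f t + g t)"
proof (rule AC_dominated[OF assms, where K = 1])
  fix s t
  show "norm (f t + g t - (f s + g s)) \<le> 1 * (norm (f t - f s) + norm (g t - g s))"
    using norm_triangle_ineq[of "f t - f s" "g t - g s"] by (simp add: algebra_simps)
qed

lemma AC_bilinear:
  assumes "bounded_bilinear mul"
    and f: "abs_continuous_on_interval a b f" and g: "abs_continuous_on_interval a b g"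
  shows "abs_continuous_on_interval a b (\<lambda>t. mul (f t) (g t))"
proof -
  interpret bounded_bilinear mul by fact
  have "bounded (f ` {a..b})" "bounded (g ` {a..b})"
    using f g by (auto intro!: compact_imp_bounded compact_continuous_image AC_continuous_on)
  then obtain Mf Mg where M: "\<And>t. t \<in> {a..b} \<Longrightarrow> norm (f t) \<le> Mf" "\<And>t. t \<in> {a..b} \<Longrightarrow> norm (g t) \<le> Mg"
    unfolding bounded_iff by blast
  obtain K where K: "\<And>p q. norm (mul p q) \<le> norm p * norm q * K" "K \<ge> 0"
    using nonneg_bounded by blast
  show ?thesis
  proof (rule AC_dominated[OF f g, where K = "(\<bar>Mf\<bar> + \<bar>Mg\<bar>) * K"])
    fix s t assume st: "a \<le> s" "s \<le> t" "t \<le> b"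
    have "mul (f t) (g t) - mul (f s) (g s) = mul (f t - f s) (g t) + mul (f s) (g t - g s)"
      by (simp add: diff_left diff_right)
    also have "norm \<dots> \<le> norm (f t - f s) * norm (g t) * K + norm (f s) * norm (g t - g s) * K"
      using K by (intro norm_triangle_le add_mono)
    also have "\<dots> \<le> norm (f t - f s) * (\<bar>Mf\<bar> + \<bar>Mg\<bar>) * K + (\<bar>Mf\<bar> + \<bar>Mg\<bar>) * norm (g t - g s) * K"
      using M[of s] M[of t] st K(2) by (intro add_mono mult_right_mono mult_left_mono) auto
    also have "\<dots> = (\<bar>Mf\<bar> + \<bar>Mg\<bar>) * K * (norm (f t - f s) + norm (g t - g s))"
      by (simp add: algebra_simps)
    finally show "norm (mul (f t) (g t) - mul (f s) (g s))
        \<le> (\<bar>Mf\<bar> + \<bar>Mg\<bar>) * K * (norm (f t - f s) + norm (g t - g s))" .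
  qed
qed

section \<open>Monotonicity and integrability from supporting functions\<close>

text \<open>A differentiable function \<open>m\<close> touches \<open>\<psi>\<close> from below at \<open>t\<close>, seen from the left.
  This is a one-sided substitute for \<open>\<psi>' t = c\<close> in the style of viscosity solutions: it bounds
  the left difference quotients of \<open>\<psi>\<close> at \<open>t\<close> from above by about \<open>c\<close>. For a convex function
  composed with a curve, a subgradient at \<open>t\<close> provides such an \<open>m\<close>.\<close>

definition left_supporting_slope :: "(real \<Rightarrow> real) \<Rightarrow> real \<Rightarrow> real \<Rightarrow> real \<Rightarrow> bool" where
  "left_supporting_slope \<psi> a t c \<longleftrightarrow>
     (\<exists>m. (m has_real_derivative c) (at t) \<and> m t = \<psi> t \<and> (\<forall>s\<in>{a..t}. m s \<le> \<psi> s))"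

lemma left_supporting_slope_bound:
  assumes "left_supporting_slope \<psi> a t c" "c < c'"
  obtains \<rho> where "\<rho> > 0" "\<And>s. a \<le> s \<Longrightarrow> t - \<rho> < s \<Longrightarrow> s \<le> t \<Longrightarrow> \<psi> t - \<psi> s \<le> c' * (t - s)"
proof -
  obtain m where m: "(m has_real_derivative c) (at t)" "m t = \<psi> t" "\<And>s. s \<in> {a..t} \<Longrightarrow> m s \<le> \<psi> s"
    using assms(1) by (auto simp: left_supporting_slope_def)
  have "((\<lambda>s. m s - c' * s) has_real_derivative c - c') (at t)"
    using m(1) by (auto intro!: derivative_eq_intros)
  then obtain \<rho> where \<rho>: "\<rho> > 0" "\<And>k. 0 < k \<Longrightarrow> k < \<rho> \<Longrightarrow> m t - c' * t < m (t - k) - c' * (t - k)"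
    using DERIV_neg_dec_left[of "\<lambda>s. m s - c' * s" "c - c'" t] assms(2) by auto
  show thesis
  proof (rule that[OF \<rho>(1)])
    fix s assume "a \<le> s" "t - \<rho> < s" "s \<le> t"
    then show "\<psi> t - \<psi> s \<le> c' * (t - s)"
      using \<rho>(2)[of "t - s"] m(2) m(3)[of s] by (cases "s = t") (auto simp: algebra_simps)
  qed
qed

text \<open>For \<open>t\<close> outside a null set \<open>N\<close>, the increase of the function from \<open>s\<close> to \<open>t\<close> is at most
  \<open>\<epsilon> (t - s)\<close> for all \<open>s\<close> slightly to the left of \<open>t\<close>. The set \<open>N\<close> is covered by an
  open set \<open>U\<close> of small measure, on which \<open>\<psi>\<close> varies little by absolute continuity. Creeping from
  \<open>b\<close> down to \<open>a\<close>, with a step of one of these two kinds at every point, bounds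
  \<open>\<psi> b - \<psi> a\<close> by \<open>\<epsilon> (b - a)\<close> plus the variation of \<open>\<psi>\<close> on \<open>U\<close>.\<close>

lemma AC_nonincreasing:
  fixes \<psi> :: "real \<Rightarrow> real"
  assumes AC: "abs_continuous_on_interval a b \<psi>" and "a \<le> b"
    and slope: "AE t in lebesgue. a < t \<and> t \<le> b \<longrightarrow> (\<exists>c\<le>0. left_supporting_slope \<psi> a t c)"
  shows "\<psi> b \<le> \<psi> a"
proof (rule field_le_epsilon)
  fix e :: real assume "e > 0"
  obtain \<eta> where \<eta>: "\<eta> > 0" "\<And>(n::nat) l r. (\<forall>i<n. a \<le> l i \<and> l i \<le> r i \<and> r i \<le> b) \<Longrightarrow>
      (\<forall>i<n. \<forall>j<n. i \<noteq> j \<longrightarrow> {l i<..<r i} \<inter> {l j<..<r j} = {}) \<Longrightarrow>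
      (\<Sum>i<n. r i - l i) < \<eta> \<Longrightarrow> (\<Sum>i<n. norm (\<psi> (r i) - \<psi> (l i))) < e / 2"
    by (rule AC_modulus[OF AC half_gt_zero[OF \<open>e > 0\<close>]]) (rule that; assumption)
  define N where "N = {t. a < t \<and> t \<le> b \<and> \<not> (\<exists>c\<le>0. left_supporting_slope \<psi> a t c)}"
  have N: "N \<in> null_sets lebesgue"
    using slope unfolding completion.AE_iff_null_sets N_def by simp
  obtain U where U: "open U" "N \<subseteq> U" "U - N \<in> lmeasurable" "emeasure lebesgue (U - N) < ennreal \<eta>"
    using sets_lebesgue_outer_open[OF null_setsD2[OF N] \<eta>(1)] by metis
  have "emeasure lebesgue U = emeasure lebesgue (U - N)"
    using U(1) N by (intro emeasure_Diff_null_set[symmetric]) auto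
  then have U_small: "emeasure lebesgue U < ennreal \<eta>"
    using U(4) by simp
  then have U_meas: "U \<in> lmeasurable"
    using U(1) by (intro fmeasurableI) (auto intro: less_trans[OF _ ennreal_less_top])
  have U_\<eta>: "measure lebesgue U < \<eta>"
    using U_small U_meas \<eta>(1) by (simp add: emeasure_eq_measure2 ennreal_less_iff)
  \<comment> \<open>The variation \<open>V s\<close> of \<open>\<psi>\<close> over the intervals of \<open>U\<close> between \<open>s\<close> and \<open>b\<close> is the total
    budget for crossing \<open>N\<close>.\<close>
  define adm where "adm = (\<lambda>s (n::nat) l r. (\<forall>i<n. s \<le> l i \<and> l i \<le> r i \<and> r i \<le> b \<and> {l i<..<r i} \<subseteq> U) \<and>
      (\<forall>i<n. \<forall>j<n. i \<noteq> j \<longrightarrow> {l i<..<r i} \<inter> {l j<..<r j} = {}))"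
  define vars where
    "vars = (\<lambda>s. {v. \<exists>n l r. adm s n l r \<and> v = (\<Sum>i<n. norm (\<psi> (r i) - \<psi> (l i)))})"
  define V where "V s = Sup (vars s)" for s
  have vars_le: "v \<le> e / 2" if "v \<in> vars s" "a \<le> s" for v s
  proof -
    from that obtain n l r where lr: "adm s n l r" and v: "v = (\<Sum>i<n. norm (\<psi> (r i) - \<psi> (l i)))"
      by (auto simp: vars_def)
    have "(\<Sum>i<n. r i - l i) = (\<Sum>i<n. measure lebesgue {l i<..<r i})"
      using lr by (intro sum.cong) (auto simp: adm_def)
    also have "\<dots> = measure lebesgue (\<Union>i<n. {l i<..<r i})"
      using lr by (intro measure_finite_Union[symmetric])
        (auto simp: adm_def disjoint_family_on_def)
    also have "\<dots> \<le> measure lebesgue U"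
      using lr by (intro measure_mono_fmeasurable U_meas) (auto simp: adm_def)
    finally have "(\<Sum>i<n. r i - l i) < \<eta>" using U_\<eta> by simp
    then show ?thesis
      unfolding v using lr that(2) by (intro less_imp_le \<eta>(2)) (auto simp: adm_def)
  qed
  have bdd: "bdd_above (vars s)" if "a \<le> s" for s
    using vars_le that by (intro bdd_aboveI[of _ "e / 2"]) auto
  have zero: "0 \<in> vars s" for s
    unfolding vars_def adm_def by (auto intro!: exI[of _ 0])
  have V_le: "V s \<le> e / 2" if "a \<le> s" for s
    unfolding V_def using zero vars_le that by (intro cSup_least) auto
  have V_nonneg: "0 \<le> V s" if "a \<le> s" for s
    unfolding V_def by (intro cSup_upper zero bdd that)
  have V_anti: "V t \<le> V s" if "a \<le> s" "s \<le> t" for s t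
    unfolding V_def
  proof (intro cSup_subset_mono bdd that)
    show "vars t \<noteq> {}" using zero by blast
    have "adm s n l r" if "adm t n l r" for n l r
      using that unfolding adm_def by (auto intro: order_trans[OF \<open>s \<le> t\<close>])
    then show "vars t \<subseteq> vars s" unfolding vars_def by blast
  qed
  have V_step: "\<psi> t - \<psi> s + V t \<le> V s" if st: "a \<le> s" "s \<le> t" "t \<le> b" "{s<..<t} \<subseteq> U" for s t
  proof -
    have "v \<le> V s - (\<psi> t - \<psi> s)" if "v \<in> vars t" for v
    proof -
      from that obtain n l r where lr: "adm t n l r" and v: "v = (\<Sum>i<n. norm (\<psi> (r i) - \<psi> (l i)))"
        by (auto simp: vars_def)
      have "adm s (Suc n) (l(n := s)) (r(n := t))"
        unfolding adm_def
      proof (intro conjI allI impI)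
        fix i assume "i < Suc n"
        then show "s \<le> (l(n := s)) i" "(l(n := s)) i \<le> (r(n := t)) i" "(r(n := t)) i \<le> b"
          "{(l(n := s)) i<..<(r(n := t)) i} \<subseteq> U"
          using lr st by (auto simp: adm_def less_Suc_eq intro: order_trans)
      next
        fix i j assume ij: "i < Suc n" "j < Suc n" "i \<noteq> j"
        have right: "{s<..<t} \<inter> {l i<..<r i} = {}" if "i < n" for i
        proof -
          have "t \<le> l i" using lr that by (auto simp: adm_def)
          then show ?thesis by auto
        qed
        consider "i < n" "j < n" | "i = n" "j < n" | "i < n" "j = n"
          using ij by linarith
        then show "{(l(n := s)) i<..<(r(n := t)) i} \<inter> {(l(n := s)) j<..<(r(n := t)) j} = {}"
        proof cases
          case 1
          then show ?thesis using lr ij by (simp add: adm_def)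
        next
          case 2
          then show ?thesis using right[of j] by simp
        next
          case 3
          then show ?thesis using right[of i] by (simp add: Int_commute)
        qed
      qed
      moreover have "(\<Sum>i<Suc n. norm (\<psi> ((r(n := t)) i) - \<psi> ((l(n := s)) i))) = v + norm (\<psi> t - \<psi> s)"
        unfolding v by simp
      ultimately have "v + norm (\<psi> t - \<psi> s) \<in> vars s"
        unfolding vars_def by (intro CollectI exI conjI) (assumption, simp)
      then have "v + norm (\<psi> t - \<psi> s) \<le> V s"
        unfolding V_def by (intro cSup_upper bdd st)
      then show ?thesis by simp
    qed
    then have "V t \<le> V s - (\<psi> t - \<psi> s)"
      unfolding V_def[of t] using zero by (intro cSup_least) auto
    then show ?thesis by simp
  qed
  define \<epsilon> where "\<epsilon> = e / (2 * (b - a + 1))"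
  have \<epsilon>: "\<epsilon> > 0" "\<epsilon> * (b - a) \<le> e / 2"
    using \<open>e > 0\<close> \<open>a \<le> b\<close> by (auto simp: \<epsilon>_def field_simps)
  \<comment> \<open>The points that creeping from \<open>b\<close> can reach within the budget.\<close>
  define S where "S = {s \<in> {a..b}. \<psi> b - \<psi> s \<le> \<epsilon> * (b - s) + V s}"
  have "b \<in> S"
    using \<open>a \<le> b\<close> V_nonneg by (simp add: S_def)
  have bddS: "bdd_below S"
    by (rule bdd_belowI[of _ a]) (simp add: S_def)
  define s0 where "s0 = Inf S"
  have s0: "a \<le> s0" "s0 \<le> b"
    unfolding s0_def using \<open>b \<in> S\<close> bddS
    by (auto intro!: cInf_greatest cInf_lower simp: S_def)
  have "s0 \<in> S"
  proof -
    have "\<psi> b - \<psi> s0 \<le> \<epsilon> * (b - s0) + V s0 + k" if k: "k > 0" for k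
    proof -
      have "s0 \<in> {a..b}" using s0 by simp
      from AC_continuous_on[OF AC, unfolded continuous_on_iff, rule_format, OF this k]
      obtain d where d: "d > 0" "\<forall>s\<in>{a..b}. dist s s0 < d \<longrightarrow> dist (\<psi> s) (\<psi> s0) < k"
        by (elim exE conjE)
      have "Inf S < s0 + d" using d(1) by (simp add: s0_def)
      then obtain s where s: "s \<in> S" "s < s0 + d"
        using cInf_lessD[of S "s0 + d"] \<open>b \<in> S\<close> by blast
      have "s0 \<le> s"
        unfolding s0_def by (intro cInf_lower bddS s)
      have "\<psi> s - \<psi> s0 \<le> k"
      proof -
        have "s \<in> {a..b}" using s(1) by (simp add: S_def)
        moreover have "dist s s0 < d" using s(2) \<open>s0 \<le> s\<close> by (simp add: dist_real_def)
        ultimately have "dist (\<psi> s) (\<psi> s0) < k" using d(2) by blast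
        then show ?thesis by (simp add: dist_real_def)
      qed
      moreover have "\<psi> b - \<psi> s \<le> \<epsilon> * (b - s) + V s"
        using s by (simp add: S_def)
      moreover have "\<epsilon> * (b - s) \<le> \<epsilon> * (b - s0)"
        using \<epsilon>(1) \<open>s0 \<le> s\<close> by simp
      moreover have "V s \<le> V s0"
        by (intro V_anti s0 \<open>s0 \<le> s\<close>)
      ultimately show ?thesis by linarith
    qed
    then have "\<psi> b - \<psi> s0 \<le> \<epsilon> * (b - s0) + V s0"
      by (rule field_le_epsilon)
    then show ?thesis using s0 by (simp add: S_def)
  qed
  have "s0 = a"
  proof (rule ccontr)
    assume "s0 \<noteq> a"
    with s0 have "a < s0" by simp
    have "\<exists>s. a \<le> s \<and> s < s0 \<and> \<psi> s0 - \<psi> s + V s0 \<le> \<epsilon> * (s0 - s) + V s"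
    proof (cases "s0 \<in> U")
      case True
      then obtain d where d: "d > 0" "ball s0 d \<subseteq> U"
        using U(1) open_contains_ball by blast
      define s where "s = max a (s0 - d)"
      have "a \<le> s" "s < s0"
        using d(1) \<open>a < s0\<close> by (auto simp: s_def)
      moreover have "{s<..<s0} \<subseteq> ball s0 d"
        by (auto simp: s_def dist_real_def)
      then have "{s<..<s0} \<subseteq> U" using d(2) by simp
      ultimately have "\<psi> s0 - \<psi> s + V s0 \<le> V s" "0 \<le> \<epsilon> * (s0 - s)"
        using V_step[of s s0] s0(2) \<epsilon>(1) by simp_all
      with \<open>a \<le> s\<close> \<open>s < s0\<close> show ?thesis
        by (intro exI[of _ s]) linarith
    next
      case False
      with U(2) \<open>a < s0\<close> s0 obtain c where c: "c \<le> 0" "left_supporting_slope \<psi> a s0 c"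
        unfolding N_def by blast
      then have "c < \<epsilon>" using \<epsilon>(1) by simp
      from left_supporting_slope_bound[OF c(2) this] obtain \<rho> where \<rho>: "\<rho> > 0"
        "\<And>s. a \<le> s \<Longrightarrow> s0 - \<rho> < s \<Longrightarrow> s \<le> s0 \<Longrightarrow> \<psi> s0 - \<psi> s \<le> \<epsilon> * (s0 - s)"
        by blast
      define s where "s = max a (s0 - \<rho> / 2)"
      have "a \<le> s" "s < s0" "s0 - \<rho> < s"
        using \<rho>(1) \<open>a < s0\<close> by (auto simp: s_def)
      with \<rho>(2)[of s] V_anti[of s s0] show ?thesis
        by (intro exI[of _ s]) linarith
    qed
    then obtain s where s: "a \<le> s" "s < s0" "\<psi> s0 - \<psi> s + V s0 \<le> \<epsilon> * (s0 - s) + V s"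
      by blast
    have "\<psi> b - \<psi> s0 \<le> \<epsilon> * (b - s0) + V s0"
      using \<open>s0 \<in> S\<close> by (simp add: S_def)
    with s s0 have "s \<in> S"
      by (auto simp: S_def algebra_simps)
    then have "s0 \<le> s"
      unfolding s0_def by (intro cInf_lower bddS)
    with s show False by simp
  qed
  with \<open>s0 \<in> S\<close> have "\<psi> b - \<psi> a \<le> \<epsilon> * (b - a) + V a"
    by (simp add: S_def)
  with \<epsilon>(2) V_le[of a] show "\<psi> b \<le> \<psi> a + e" by simp
qed

text \<open>Measurability of the quantities that involve velocities comes from here, with difference
  quotients as the continuous approximations.\<close>

lemma set_borel_measurable_AE_limit:
  fixes h :: "real \<Rightarrow> real"
  assumes cont: "\<And>n. continuous_on {0<..} (F n)"
    and lim: "AE t in lebesgue. t > 0 \<longrightarrow> (\<lambda>n. F n t) \<longlonglongrightarrow> h t"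
  shows "set_borel_measurable lebesgue {0<..} h"
proof -
  have "(\<lambda>t. indicat_real {0<..} t *\<^sub>R F n t) \<in> borel_measurable borel" for n
    by (intro borel_measurable_continuous_on_indicator cont) auto
  then have [measurable]: "(\<lambda>t. indicat_real {0<..} t *\<^sub>R F n t) \<in> borel_measurable lebesgue" for n
    by (intro measurable_completion) simp
  have "(\<lambda>t. lim (\<lambda>n. indicat_real {0<..} t *\<^sub>R F n t)) \<in> borel_measurable lebesgue"
    by (intro borel_measurable_lim_metric) measurable
  moreover have "AE t in lebesgue. lim (\<lambda>n. indicat_real {0<..} t *\<^sub>R F n t) = indicat_real {0<..} t *\<^sub>R h t"
    using lim by eventually_elim (auto simp: indicator_def limI)
  ultimately show ?thesis
    unfolding set_borel_measurable_def by (rule borel_measurable_AE)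
qed

text \<open>The left difference quotients of \<open>-\<psi>\<close> are nonnegative and their lower limit dominates
  \<open>h\<close> almost everywhere. Their integrals telescope to averages of \<open>\<psi>\<close> and are bounded by
  \<open>\<psi> 0\<close>, so Fatou's lemma bounds the integral of \<open>h\<close> by \<open>\<psi> 0\<close>.\<close>

lemma supporting_slope_integrable:
  fixes \<psi> h :: "real \<Rightarrow> real"
  assumes cont: "continuous_on {0..} \<psi>"
    and anti: "\<And>s t. 0 \<le> s \<Longrightarrow> s \<le> t \<Longrightarrow> \<psi> t \<le> \<psi> s"
    and nonneg: "\<And>t. 0 \<le> t \<Longrightarrow> 0 \<le> \<psi> t"
    and meas: "set_borel_measurable lebesgue {0<..} h"
    and h: "AE t in lebesgue. t > 0 \<longrightarrow> 0 \<le> h t"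
    and slope: "AE t in lebesgue. t > 0 \<longrightarrow> (\<exists>c \<le> - h t. left_supporting_slope \<psi> 0 t c)"
  shows "set_integrable lebesgue {0<..} h"
proof -
  \<comment> \<open>The quotients with step \<open>1 / k n\<close> are cut off to \<open>[1 / k n, k n]\<close>, so that they stay on the
    half-line and have finite integrals; every \<open>t > 0\<close> lies in these intervals eventually.\<close>
  define k where "k = (\<lambda>n. real (Suc n))"
  have k: "k n \<ge> 1" "k n > 0" "1 / k n > 0" "1 / k n \<le> k n" for n
  proof -
    show "k n \<ge> 1" "k n > 0" "1 / k n > 0" by (simp_all add: k_def)
    then have "1 / k n \<le> 1" by simp
    with \<open>k n \<ge> 1\<close> show "1 / k n \<le> k n" by linarith
  qed
  define q where "q = (\<lambda>n t. k n * (\<psi> (t - 1 / k n) - \<psi> t))"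
  define u where "u = (\<lambda>n t. ennreal (q n t) * indicator {1 / k n..k n} t)"
  have q_nonneg: "0 \<le> q n t" if "1 / k n \<le> t" for n t
    using anti[of "t - 1 / k n" t] that k[of n] by (simp add: q_def)
  have cont_q: "continuous_on {1 / k n..k n} (q n)" for n
    unfolding q_def using k(3)[of n]
    by (intro continuous_intros continuous_on_compose2[OF cont] ) (auto intro: order_trans)
  have u_meas: "u n \<in> borel_measurable lebesgue" for n
  proof -
    have "(\<lambda>t. indicat_real {1 / k n..k n} t *\<^sub>R q n t) \<in> borel_measurable borel"
      by (intro borel_measurable_continuous_on_indicator cont_q) auto
    then have "(\<lambda>t. ennreal (indicat_real {1 / k n..k n} t *\<^sub>R q n t)) \<in> borel_measurable lebesgue"
      by (intro measurable_completion) simp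
    also have "(\<lambda>t. ennreal (indicat_real {1 / k n..k n} t *\<^sub>R q n t)) = u n"
      by (auto simp: u_def indicator_def fun_eq_iff)
    finally show ?thesis .
  qed
  have u_int: "(\<integral>\<^sup>+ t. u n t \<partial>lebesgue) \<le> ennreal (\<psi> 0)" for n
  proof -
    \<comment> \<open>The quotient has the antiderivative \<open>k (G (t - 1 / k) - G t)\<close>, whose values at the ends of the
      interval are, up to sign, averages of \<open>\<psi>\<close>.\<close>
    define G where "G = (\<lambda>t. integral {0..t} \<psi>)"
    have contn: "continuous_on {0..k n} \<psi>"
      by (rule continuous_on_subset[OF cont]) auto
    have int: "\<psi> integrable_on {0..t}" if "t \<le> k n" for t
      using that by (intro integrable_continuous_real continuous_on_subset[OF cont]) auto
    have G: "(G has_real_derivative \<psi> t) (at t within {0..k n})" if "t \<in> {0..k n}" for t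
      unfolding G_def by (rule integral_has_real_derivative[OF contn that])
    have "((\<lambda>t. k n * (G (t - 1 / k n) - G t)) has_real_derivative q n t) (at t within {1 / k n..k n})"
      if t: "t \<in> {1 / k n..k n}" for t
    proof -
      have "(G has_real_derivative \<psi> (t - 1 / k n))
          (at (t - 1 / k n) within (\<lambda>t. t - 1 / k n) ` {1 / k n..k n})"
        by (rule DERIV_subset[OF G])
          (use t k(2)[of n] in \<open>auto simp: algebra_simps intro: add_increasing2\<close>)
      moreover have "((\<lambda>t. t - 1 / k n) has_real_derivative 1) (at t within {1 / k n..k n})"
        by (auto intro!: derivative_eq_intros)
      ultimately have "(G \<circ> (\<lambda>t. t - 1 / k n) has_real_derivative \<psi> (t - 1 / k n) * 1)
          (at t within {1 / k n..k n})"
        by (rule DERIV_image_chain)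
      then have "((\<lambda>t. G (t - 1 / k n)) has_real_derivative \<psi> (t - 1 / k n)) (at t within {1 / k n..k n})"
        by (simp add: o_def)
      moreover have "(G has_real_derivative \<psi> t) (at t within {1 / k n..k n})"
      proof (rule DERIV_subset[OF G])
        have "0 \<le> t" using t less_imp_le[OF k(3)[of n]] by (meson atLeastAtMost_iff order_trans)
        then show "t \<in> {0..k n}" using t by simp
        show "{1 / k n..k n} \<subseteq> {0..k n}" using less_imp_le[OF k(3)[of n]] by (simp add: atLeastatMost_subset_iff)
      qed
      ultimately show ?thesis
        unfolding q_def by (auto intro!: derivative_eq_intros)
    qed
    then have "(q n has_integral k n * (G (k n - 1 / k n) - G (k n)) - k n * (G (1 / k n - 1 / k n) - G (1 / k n)))
        {1 / k n..k n}"
      by (intro fundamental_theorem_of_calculus k)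
        (auto simp: has_real_derivative_iff_has_vector_derivative[symmetric])
    then have "(\<integral>\<^sup>+ t. u n t \<partial>lebesgue)
        = ennreal (k n * (G (k n - 1 / k n) - G (k n)) - k n * (G (1 / k n - 1 / k n) - G (1 / k n)))"
      unfolding u_def nn_integral_completion
      by (intro nn_integral_has_integral_lebesgue') (auto intro: q_nonneg)
    also have "\<dots> \<le> ennreal (\<psi> 0)"
    proof (rule ennreal_leI)
      have "G (k n - 1 / k n) \<le> G (k n)"
        unfolding G_def using k(3)[of n] by (intro integral_subset_le int) (auto intro: nonneg)
      then have "k n * (G (k n - 1 / k n) - G (k n)) \<le> 0"
        using k(2)[of n] by (simp add: mult_le_0_iff)
      moreover have "G (1 / k n) \<le> 1 / k n * \<psi> 0"
      proof -
        have "integral {0..1 / k n} \<psi> \<le> integral {0..1 / k n} (\<lambda>_. \<psi> 0)"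
          by (intro integral_le int k) (auto intro: anti)
        also have "\<dots> = 1 / k n * \<psi> 0" using k(2)[of n] by simp
        finally show ?thesis by (simp add: G_def)
      qed
      then have "k n * G (1 / k n) \<le> \<psi> 0"
        using k(2)[of n] by (simp add: field_simps)
      moreover have "G (1 / k n - 1 / k n) = 0" by (simp add: G_def)
      ultimately show "k n * (G (k n - 1 / k n) - G (k n)) - k n * (G (1 / k n - 1 / k n) - G (1 / k n)) \<le> \<psi> 0"
        by simp
    qed
    finally show ?thesis .
  qed
  have k_lim: "(\<lambda>n. 1 / k n) \<longlonglongrightarrow> 0"
    unfolding k_def by (rule LIMSEQ_Suc[OF lim_1_over_n])
  have k_top: "filterlim k at_top sequentially"
    unfolding k_def by (rule filterlim_compose[OF filterlim_real_sequentially filterlim_Suc])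
  have lower: "AE t in lebesgue. ennreal (indicat_real {0<..} t *\<^sub>R h t) \<le> liminf (\<lambda>n. u n t)"
    using slope
  proof eventually_elim
    case (elim t)
    show ?case
    proof (cases "t > 0")
      case False
      then show ?thesis by simp
    next
      case True
      with elim obtain c where c: "c \<le> - h t" "left_supporting_slope \<psi> 0 t c" by auto
      have "\<forall>\<^sub>F n in sequentially. y < u n t" if y: "y < ennreal (h t)" for y
      proof -
        obtain y' where y': "y = ennreal y'" "y' \<ge> 0"
          using y by (cases y) auto
        with y have "y' < h t" by (simp add: ennreal_less_iff)
        then obtain r where r: "y' < r" "r < h t" using dense by blast
        with c have "c < - r" by simp
        then obtain \<rho> where \<rho>: "\<rho> > 0"
          "\<And>s. 0 \<le> s \<Longrightarrow> t - \<rho> < s \<Longrightarrow> s \<le> t \<Longrightarrow> \<psi> t - \<psi> s \<le> - r * (t - s)"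
          using left_supporting_slope_bound[OF c(2)] by blast
        have "\<forall>\<^sub>F n in sequentially. 1 / k n < min \<rho> t"
          using order_tendstoD(2)[OF k_lim, of "min \<rho> t"] \<rho>(1) True by simp
        moreover have "\<forall>\<^sub>F n in sequentially. t \<le> k n"
          using k_top by (simp add: filterlim_at_top)
        ultimately show ?thesis
        proof eventually_elim
          case (elim n)
          then have "\<psi> t - \<psi> (t - 1 / k n) \<le> - r * (1 / k n)"
            using \<rho>(2)[of "t - 1 / k n"] k(3)[of n] by auto
          then have "r \<le> q n t"
            using k(2)[of n] by (simp add: q_def field_simps)
          then show ?case
            using elim r y' by (simp add: u_def ennreal_less_iff)
        qed
      qed
      then show ?thesis
        using True by (simp add: le_Liminf_iff)
    qed
  qed
  have "(\<integral>\<^sup>+ t. ennreal (indicat_real {0<..} t *\<^sub>R h t) \<partial>lebesgue) \<le> (\<integral>\<^sup>+ t. liminf (\<lambda>n. u n t) \<partial>lebesgue)"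
    by (rule nn_integral_mono_AE[OF lower])
  also have "\<dots> \<le> liminf (\<lambda>n. \<integral>\<^sup>+ t. u n t \<partial>lebesgue)"
    by (rule nn_integral_liminf[OF u_meas])
  also have "\<dots> \<le> ennreal (\<psi> 0)"
    by (rule Liminf_le) (use u_int in auto)
  finally have "(\<integral>\<^sup>+ t. ennreal (indicat_real {0<..} t *\<^sub>R h t) \<partial>lebesgue) < \<infinity>"
    by (rule le_less_trans) simp
  then show ?thesis
    unfolding set_integrable_def using meas h
    by (intro integrableI_nonneg) (auto simp: set_borel_measurable_def indicator_def elim!: eventually_mono)
qed

section \<open>The primal-dual flow\<close>

lemma fenchel_conjugate_gt_MInf:
  assumes "proper g"
  shows "fenchel_conjugate g w \<noteq> -\<infinity>"
proof -
  from assms obtain z where "g z \<noteq> \<infinity>" "g z \<noteq> -\<infinity>" by (auto simp: proper_def)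
  then obtain a where "g z = ereal a" by (cases "g z") auto
  then have "ereal (w \<bullet> z - a) \<le> fenchel_conjugate g w"
    unfolding fenchel_conjugate_def by (intro SUP_upper2[of z]) auto
  then show ?thesis by auto
qed

lemma difference_quotient_tendsto:
  assumes "(z has_vector_derivative z') (at t)"
  shows "(\<lambda>n. real (Suc n) *\<^sub>R (z (t + 1 / real (Suc n)) - z t)) \<longlonglongrightarrow> z'"
proof -
  have "(\<lambda>n. t + 1 / real (Suc n)) \<longlonglongrightarrow> t + 0"
    by (intro tendsto_add tendsto_const LIMSEQ_Suc[OF lim_1_over_n])
  then have "filterlim (\<lambda>n. t + 1 / real (Suc n)) (at t) sequentially"
    unfolding filterlim_at by (simp add: eventually_sequentially)
  moreover have "((\<lambda>s. norm (z s - z t - (s - t) *\<^sub>R z') / norm (s - t)) \<longlongrightarrow> 0) (at t)"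
    using assms unfolding has_vector_derivative_def has_derivative_iff_norm by simp
  ultimately have "(\<lambda>n. norm (z (t + 1 / real (Suc n)) - z t - (t + 1 / real (Suc n) - t) *\<^sub>R z')
      / norm (t + 1 / real (Suc n) - t)) \<longlonglongrightarrow> 0"
    by (rule filterlim_compose[rotated])
  moreover have "norm (z (t + 1 / real (Suc n)) - z t - (t + 1 / real (Suc n) - t) *\<^sub>R z')
      / norm (t + 1 / real (Suc n) - t)
      = norm (real (Suc n) *\<^sub>R (z (t + 1 / real (Suc n)) - z t) - z')" for n
  proof -
    have "real (Suc n) *\<^sub>R (z (t + 1 / real (Suc n)) - z t) - z'
        = real (Suc n) *\<^sub>R (z (t + 1 / real (Suc n)) - z t - (t + 1 / real (Suc n) - t) *\<^sub>R z')"
      by (simp add: scaleR_diff_right del: of_nat_Suc)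
    then have "norm (real (Suc n) *\<^sub>R (z (t + 1 / real (Suc n)) - z t) - z')
        = real (Suc n) * norm (z (t + 1 / real (Suc n)) - z t - (t + 1 / real (Suc n) - t) *\<^sub>R z')"
      by (simp only: norm_scaleR abs_of_nat)
    then show ?thesis by simp
  qed
  ultimately have "(\<lambda>n. norm (real (Suc n) *\<^sub>R (z (t + 1 / real (Suc n)) - z t) - z')) \<longlonglongrightarrow> 0"
    by simp
  then show ?thesis
    by (simp only: tendsto_norm_zero_iff LIM_zero_iff)
qed

lemma difference_quotient_continuous:
  fixes z :: "real \<Rightarrow> 'a::real_normed_vector"
  assumes "continuous_on {0..} z" "k > 0"
  shows "continuous_on {0<..} (\<lambda>t. k *\<^sub>R (z (t + 1 / k) - z t))"
proof -
  have "continuous_on {0<..} (\<lambda>t. z (t + 1 / k))"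
    using assms(2)
    by (intro continuous_on_compose2[OF assms(1)] continuous_intros) (auto intro!: add_nonneg_nonneg)
  moreover have "continuous_on {0<..} z"
    by (rule continuous_on_subset[OF assms(1)]) auto
  ultimately show ?thesis by (intro continuous_intros)
qed

text \<open>Here \<open>D\<close> is the decay factor \<open>exp (- \<integral> 1 / \<beta>)\<close>. It satisfies \<open>D' = - D / \<beta>\<close>, and
  up to constants it is both \<open>\<alpha> / \<beta>\<close> and \<open>\<delta> / \<beta>\<close>.\<close>

locale primal_dual_flow =
  fixes f :: "'a::{real_inner, complete_space} \<Rightarrow> ereal"
    and g :: "'b::{real_inner, complete_space} \<Rightarrow> ereal"
    and A :: "'a \<Rightarrow> 'b"
    and \<alpha> \<beta> \<gamma> \<delta> :: "real \<Rightarrow> real"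
    and \<alpha>0 \<beta>0 \<delta>0 :: real
    and x :: "real \<Rightarrow> 'a" and y :: "real \<Rightarrow> 'b"
    and D :: "real \<Rightarrow> real"
  assumes f_proper: "proper f"
    and g_proper: "proper g"
    and A: "bounded_linear A"
    and \<beta>_pos: "\<And>t. t \<ge> 0 \<Longrightarrow> \<beta> t > 0"
    and \<beta>_cont: "continuous_on {0..} \<beta>"
    and \<beta>0: "\<beta>0 > 0"
    and pos: "\<alpha>0 > 0" "\<delta>0 > 0"
    and D_def: "\<And>t. D t = exp (- integral {0..t} (\<lambda>s. 1 / \<beta> s))"
    and \<alpha>: "\<And>t. t \<ge> 0 \<Longrightarrow> \<alpha> t = \<alpha>0 / \<beta>0 * \<beta> t * D t"
    and \<gamma>: "\<And>t. t \<ge> 0 \<Longrightarrow> \<gamma> t = - \<beta> t"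
    and \<delta>: "\<And>t. t \<ge> 0 \<Longrightarrow> \<delta> t = \<delta>0 / \<beta>0 * \<beta> t * D t"
    and traj: "trajectory f g A \<alpha> \<beta> \<gamma> \<delta> x y"
begin

abbreviation gc :: "'b \<Rightarrow> ereal" where "gc \<equiv> fenchel_conjugate g"
abbreviation fr :: "'a \<Rightarrow> real" where "fr u \<equiv> real_of_ereal (f u)"
abbreviation gr :: "'b \<Rightarrow> real" where "gr v \<equiv> real_of_ereal (gc v)"
abbreviation x' :: "real \<Rightarrow> 'a" where "x' t \<equiv> vector_derivative x (at t)"
abbreviation y' :: "real \<Rightarrow> 'b" where "y' t \<equiv> vector_derivative y (at t)"
abbreviation X :: "real \<Rightarrow> 'a" where "X \<equiv> primal_subgradient A \<alpha> \<beta> x y"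
abbreviation Y :: "real \<Rightarrow> 'b" where "Y \<equiv> dual_subgradient A \<gamma> \<delta> x y"

definition finite_at :: "'a \<Rightarrow> 'b \<Rightarrow> bool" where
  "finite_at u v \<longleftrightarrow> \<bar>f u\<bar> \<noteq> \<infinity> \<and> \<bar>gc v\<bar> \<noteq> \<infinity>"

definition primal_gap :: "'a \<Rightarrow> 'b \<Rightarrow> real \<Rightarrow> real" where
  "primal_gap u v t = fr (x t) - fr u + v \<bullet> A (x t - u)"

definition dual_gap :: "'a \<Rightarrow> 'b \<Rightarrow> real \<Rightarrow> real" where
  "dual_gap u v t = gr (y t) - gr v - (y t - v) \<bullet> A u"

text \<open>Since \<open>\<alpha> / (2 \<beta>)\<close> equals \<open>\<alpha>0 / (2 \<beta>0) D\<close>, and likewise for \<open>\<delta>\<close>, this is the energy with its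
  time-dependent weights written as multiples of \<open>D\<close>.\<close>

definition real_energy :: "'a \<Rightarrow> 'b \<Rightarrow> real \<Rightarrow> real" where
  "real_energy u v t = primal_gap u v t + dual_gap u v t
     + D t * (\<alpha>0 / (2 * \<beta>0) * (norm (x t - u))\<^sup>2 + \<delta>0 / (2 * \<beta>0) * (norm (y t - v))\<^sup>2)"

definition real_bregman :: "'a \<Rightarrow> 'b \<Rightarrow> real \<Rightarrow> real" where
  "real_bregman u v t = (fr u - fr (x t) - X t \<bullet> (u - x t)) + (gr v - gr (y t) - Y t \<bullet> (v - y t))"

definition regular :: "real \<Rightarrow> bool" where
  "regular t \<longleftrightarrow> (x has_vector_derivative x' t) (at t) \<and> (y has_vector_derivative y' t) (at t) \<and>
     X t \<in> subdifferential f (x t) \<and> Y t \<in> subdifferential gc (y t)"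

lemma A_simps: "A (p + q) = A p + A q" "A (p - q) = A p - A q" "A 0 = 0"
  using A by (simp_all add: linear_add linear_diff linear_0 bounded_linear.linear)

lemma adjoint_inner: "adjoint A w \<bullet> z = w \<bullet> A z"
  using inner_adjoint[OF A, of z w] by (simp add: inner_commute)

lemma traj_finite: "t \<ge> 0 \<Longrightarrow> \<bar>f (x t)\<bar> \<noteq> \<infinity>" "t \<ge> 0 \<Longrightarrow> \<bar>gc (y t)\<bar> \<noteq> \<infinity>"
  using traj by (auto simp: trajectory_def)

lemma finite_values:
  assumes "finite_at u v" "t \<ge> 0"
  obtains a b c e where "f (x t) = ereal a" "gc (y t) = ereal b" "f u = ereal c" "gc v = ereal e"
  using assms traj_finite[of t] unfolding finite_at_def by (metis abs_neq_infinity_cases)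

lemma AC_traj:
  assumes "T \<ge> 0"
  shows "abs_continuous_on_interval 0 T x" "abs_continuous_on_interval 0 T y"
    "abs_continuous_on_interval 0 T (\<lambda>t. fr (x t))" "abs_continuous_on_interval 0 T (\<lambda>t. gr (y t))"
  using traj assms by (simp_all add: trajectory_def locally_abs_continuous_def)

lemma continuous_on_half_line:
  fixes z :: "real \<Rightarrow> 'c::real_normed_vector"
  assumes "\<And>T. T \<ge> 0 \<Longrightarrow> abs_continuous_on_interval 0 T z"
  shows "continuous_on {0..} z"
proof -
  have "continuous (at t within {0..}) z" if "t \<ge> 0" for t
  proof -
    have "continuous_on {0..t + 1} z"
      using assms[of "t + 1"] that by (simp add: AC_continuous_on)
    then have "continuous (at t within {0..t + 1}) z"
      using that by (simp add: continuous_on_eq_continuous_within)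
    moreover have "at t within {0..t + 1} = at t within {0..}"
      by (rule at_within_nhd[of _ "{..<t + 1}"]) auto
    ultimately show ?thesis by simp
  qed
  then show ?thesis by (simp add: continuous_on_eq_continuous_within)
qed

lemma regular_AE: "AE t in lebesgue. t > 0 \<longrightarrow> regular t"
proof -
  have "AE t in lebesgue. t > 0 \<longrightarrow>
        (\<exists>x' y'. (x has_vector_derivative x') (at t) \<and> (y has_vector_derivative y') (at t) \<and>
          (\<exists>p \<in> subdifferential f (x t).
             \<alpha> t *\<^sub>R x' + \<beta> t *\<^sub>R adjoint A y' + p + adjoint A (y t) = 0) \<and>
          (\<exists>q \<in> subdifferential gc (y t).
             \<gamma> t *\<^sub>R A x' + \<delta> t *\<^sub>R y' - A (x t) + q = 0))"
    using traj by (simp add: trajectory_def)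
  then show ?thesis
  proof (eventually_elim, intro impI)
    fix t :: real
    assume H: "t > 0 \<longrightarrow>
        (\<exists>x' y'. (x has_vector_derivative x') (at t) \<and> (y has_vector_derivative y') (at t) \<and>
          (\<exists>p \<in> subdifferential f (x t).
             \<alpha> t *\<^sub>R x' + \<beta> t *\<^sub>R adjoint A y' + p + adjoint A (y t) = 0) \<and>
          (\<exists>q \<in> subdifferential gc (y t).
             \<gamma> t *\<^sub>R A x' + \<delta> t *\<^sub>R y' - A (x t) + q = 0))" and "t > 0"
    then obtain a b p q where d: "(x has_vector_derivative a) (at t)" "(y has_vector_derivative b) (at t)"
      and p: "p \<in> subdifferential f (x t)" "\<alpha> t *\<^sub>R a + \<beta> t *\<^sub>R adjoint A b + p + adjoint A (y t) = 0"
      and q: "q \<in> subdifferential gc (y t)" "\<gamma> t *\<^sub>R A a + \<delta> t *\<^sub>R b - A (x t) + q = 0"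
      by blast
    have ab: "x' t = a" "y' t = b"
      using d by (simp_all add: vector_derivative_at)
    have "X t = X t + (\<alpha> t *\<^sub>R a + \<beta> t *\<^sub>R adjoint A b + p + adjoint A (y t))"
      using p(2) by simp
    also have "\<dots> = p"
      by (simp add: primal_subgradient_def ab)
    finally have "X t = p" .
    have "Y t = Y t + (\<gamma> t *\<^sub>R A a + \<delta> t *\<^sub>R b - A (x t) + q)"
      using q(2) by simp
    also have "\<dots> = q"
      by (simp add: dual_subgradient_def ab)
    finally have "Y t = q" .
    with \<open>X t = p\<close> d p q ab show "regular t"
      by (simp add: regular_def)
  qed
qed

subsection \<open>The decay factor\<close>

lemma \<beta>_nonzero: "t \<ge> 0 \<Longrightarrow> \<beta> t \<noteq> 0"
  using \<beta>_pos[of t] by simp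

lemma D_pos: "D t > 0"
  by (simp add: D_def)

lemma D_0: "D 0 = 1"
  by (simp add: D_def)

lemma inverse_\<beta>_cont: "continuous_on {0..} (\<lambda>s. 1 / \<beta> s)"
  by (intro continuous_intros \<beta>_cont) (simp add: \<beta>_nonzero)

lemma D_deriv_within:
  assumes "t \<in> {0..T}"
  shows "(D has_real_derivative - D t / \<beta> t) (at t within {0..T})"
proof -
  have "continuous_on {0..T} (\<lambda>s. 1 / \<beta> s)"
    by (rule continuous_on_subset[OF inverse_\<beta>_cont]) auto
  from integral_has_real_derivative[OF this assms] show ?thesis
    unfolding D_def by (auto intro!: derivative_eq_intros)
qed

lemma D_deriv:
  assumes "t > 0"
  shows "(D has_real_derivative - D t / \<beta> t) (at t)"
proof -
  have "at t within {0..t + 1} = at t"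
    using assms by (intro at_within_interior) auto
  with D_deriv_within[of t "t + 1"] assms show ?thesis by simp
qed

lemma D_continuous: "continuous_on {0..T} D"
  using D_deriv_within by (rule DERIV_continuous_on)

lemma AC_D: "abs_continuous_on_interval 0 T D"
proof (rule AC_C1[OF D_deriv_within])
  show "continuous_on {0..T} (\<lambda>t. - D t / \<beta> t)"
    by (intro continuous_intros D_continuous continuous_on_subset[OF \<beta>_cont]) (auto simp: \<beta>_nonzero)
qed

lemma AC_inverse_D: "abs_continuous_on_interval 0 T (\<lambda>t. 1 / D t)"
proof (rule AC_C1)
  show "((\<lambda>t. 1 / D t) has_real_derivative 1 / (D t * \<beta> t)) (at t within {0..T})" if "t \<in> {0..T}" for t
    using D_deriv_within[OF that] D_pos[of t] \<beta>_pos[of t] that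
    by (auto intro!: derivative_eq_intros simp: field_simps)
  show "continuous_on {0..T} (\<lambda>t. 1 / (D t * \<beta> t))"
    by (intro continuous_intros D_continuous continuous_on_subset[OF \<beta>_cont])
      (use D_pos in \<open>auto simp: \<beta>_nonzero less_imp_neq[symmetric]\<close>)
qed

lemma \<alpha>_pos: "t \<ge> 0 \<Longrightarrow> \<alpha> t > 0" and \<delta>_pos: "t \<ge> 0 \<Longrightarrow> \<delta> t > 0"
  using \<alpha>[of t] \<delta>[of t] \<beta>_pos[of t] D_pos[of t] pos \<beta>0 by simp_all

subsection \<open>The energy\<close>

lemma duality_gap_eq:
  assumes "finite_at u v" "t \<ge> 0"
  shows "duality_gap f g A x y u v t = ereal (primal_gap u v t + dual_gap u v t)"
proof -
  obtain a b c e where [simp]: "f (x t) = ereal a" "gc (y t) = ereal b" "f u = ereal c" "gc v = ereal e"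
    by (rule finite_values[OF assms])
  show ?thesis
    by (simp add: duality_gap_def lagrangian_def primal_gap_def dual_gap_def A_simps inner_simps)
qed

lemma energy_eq:
  assumes "finite_at u v" "t \<ge> 0"
  shows "energy f g A \<alpha> \<beta> \<delta> x y u v t = ereal (real_energy u v t)"
proof -
  have "\<alpha> t / (2 * \<beta> t) = D t * (\<alpha>0 / (2 * \<beta>0))" "\<delta> t / (2 * \<beta> t) = D t * (\<delta>0 / (2 * \<beta>0))"
    using \<alpha>[of t] \<delta>[of t] \<beta>_pos[of t] assms(2) by (simp_all add: field_simps)
  then show ?thesis
    unfolding energy_def duality_gap_eq[OF assms] real_energy_def
    by (simp add: algebra_simps)
qed

lemma bregman_eq:
  assumes "finite_at u v" "t \<ge> 0"
  shows "bregman f g A \<alpha> \<beta> \<gamma> \<delta> x y u v t = ereal (real_bregman u v t)"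
proof -
  obtain a b c e where [simp]: "f (x t) = ereal a" "gc (y t) = ereal b" "f u = ereal c" "gc v = ereal e"
    by (rule finite_values[OF assms])
  show ?thesis
    by (simp add: bregman_def real_bregman_def)
qed

lemma X_inner:
  "X t \<bullet> z = - \<alpha> t * (x' t \<bullet> z) - \<beta> t * (y' t \<bullet> A z) - y t \<bullet> A z"
  by (simp add: primal_subgradient_def inner_simps adjoint_inner)

lemma Y_inner:
  "t \<ge> 0 \<Longrightarrow> Y t \<bullet> w = \<beta> t * (A (x' t) \<bullet> w) - \<delta> t * (y' t \<bullet> w) + A (x t) \<bullet> w"
  by (simp add: dual_subgradient_def inner_simps \<gamma>)

lemma bregman_nonneg:
  assumes "regular t" "finite_at u v"
  shows "0 \<le> real_bregman u v t"
  using subdifferential_real[of "X t" f "x t" u] subdifferential_real[of "Y t" gc "y t" v] assms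
  by (auto simp: regular_def finite_at_def real_bregman_def)

text \<open>This is the dissipation identity
  \<open>E' = - \<alpha> |x'|\<^sup>2 - \<delta> |y'|\<^sup>2 - d / \<beta> - E / \<beta>\<close> for the energy, in the sense of supporting
  functions: \<open>m\<close> is the energy in which \<open>f (x s)\<close> and the conjugate at \<open>y s\<close> are replaced by
  their affine minorants with slopes \<open>X t\<close> and \<open>Y t\<close>. In the derivative of the gap, the terms
  \<open>\<beta> (y' \<bullet> A x')\<close> from the two equations cancel because \<open>\<gamma> = - \<beta>\<close>. What remains besides the
  kinetic terms is \<open>A (x - u) \<bullet> y' - (y - v) \<bullet> A x'\<close>, which occurs in the Bregman divergence
  with the factor \<open>- \<beta>\<close>; the inner products of velocities with \<open>x - u\<close> and \<open>y - v\<close> that this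
  substitution brings in cancel against the derivative of the quadratic part of the energy.\<close>

lemma real_energy_supporting:
  assumes t: "t > 0" and reg: "regular t" and uv: "finite_at u v"
  obtains m where
    "(m has_real_derivative - \<alpha> t * (norm (x' t))\<^sup>2 - \<delta> t * (norm (y' t))\<^sup>2
        - real_bregman u v t / \<beta> t - real_energy u v t / \<beta> t) (at t)"
    "m t = real_energy u v t" "\<And>s. s \<ge> 0 \<Longrightarrow> m s \<le> real_energy u v s"
proof -
  have dx: "(x has_vector_derivative x' t) (at t)" and dy: "(y has_vector_derivative y' t) (at t)"
    using reg by (simp_all add: regular_def)
  have in_deriv: "((\<lambda>s. z s \<bullet> w s) has_real_derivative z t \<bullet> w' + z' \<bullet> w t) (at t)"
    if "(z has_vector_derivative z') (at t)" "(w has_vector_derivative w') (at t)"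
    for z w :: "real \<Rightarrow> 'c::real_inner" and z' w'
    using has_derivative_inner[OF that[unfolded has_vector_derivative_def]]
    unfolding has_field_derivative_def
    by (rule has_derivative_eq_rhs) (simp add: fun_eq_iff algebra_simps)
  have dA: "((\<lambda>s. A (x s)) has_vector_derivative A (x' t)) (at t)"
    by (rule bounded_linear.has_vector_derivative[OF A dx])
  define a where "a = \<alpha>0 / \<beta>0"
  define b where "b = \<delta>0 / \<beta>0"
  define m where "m = (\<lambda>s. (fr (x t) + X t \<bullet> (x s - x t)) - fr u + v \<bullet> (A (x s) - A u)
     + (gr (y t) + Y t \<bullet> (y s - y t)) - gr v - (y s - v) \<bullet> A u
     + D s * (a / 2 * ((x s - u) \<bullet> (x s - u)) + b / 2 * ((y s - v) \<bullet> (y s - v))))"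
  have raw: "(m has_real_derivative X t \<bullet> x' t + v \<bullet> A (x' t) + Y t \<bullet> y' t - y' t \<bullet> A u
      + (- D t / \<beta> t * (a / 2 * ((x t - u) \<bullet> (x t - u)) + b / 2 * ((y t - v) \<bullet> (y t - v)))
        + D t * (a * (x' t \<bullet> (x t - u)) + b * (y' t \<bullet> (y t - v))))) (at t)"
    unfolding m_def
    by (rule derivative_eq_intros in_deriv D_deriv[OF t] dx dy dA has_vector_derivative_diff
        has_vector_derivative_const refl | simp add: inner_commute)+
  have E: "real_energy u v s = (fr (x s) - fr u + v \<bullet> (A (x s) - A u)) + (gr (y s) - gr v - (y s - v) \<bullet> A u)
      + D s * (a / 2 * ((x s - u) \<bullet> (x s - u)) + b / 2 * ((y s - v) \<bullet> (y s - v)))" for s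
    by (simp add: real_energy_def primal_gap_def dual_gap_def a_def b_def power2_norm_eq_inner A_simps)
  have \<beta>: "\<beta> t > 0" and ab: "\<alpha> t = a * \<beta> t * D t" "\<delta> t = b * \<beta> t * D t"
    using \<alpha>[of t] \<delta>[of t] \<beta>_pos[of t] t by (simp_all add: a_def b_def)
  have Xi: "X t \<bullet> z = - \<alpha> t * (x' t \<bullet> z) - \<beta> t * (y' t \<bullet> A z) - y t \<bullet> A z" for z
    by (rule X_inner)
  have Yi: "Y t \<bullet> w = \<beta> t * (A (x' t) \<bullet> w) - \<delta> t * (y' t \<bullet> w) + A (x t) \<bullet> w" for w
    using t by (simp add: Y_inner)
  have eq: "X t \<bullet> x' t + v \<bullet> A (x' t) + Y t \<bullet> y' t - y' t \<bullet> A u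
      + (- D t / \<beta> t * (a / 2 * ((x t - u) \<bullet> (x t - u)) + b / 2 * ((y t - v) \<bullet> (y t - v)))
        + D t * (a * (x' t \<bullet> (x t - u)) + b * (y' t \<bullet> (y t - v))))
    = - \<alpha> t * (norm (x' t))\<^sup>2 - \<delta> t * (norm (y' t))\<^sup>2
        - real_bregman u v t / \<beta> t - real_energy u v t / \<beta> t"
    unfolding E real_bregman_def power2_norm_eq_inner Xi Yi A_simps ab using \<beta>
    by (simp add: inner_simps inner_commute field_simps)
  show thesis
  proof (rule that[of m])
    show "m t = real_energy u v t"
      by (simp add: m_def E)
    show "m s \<le> real_energy u v s" if "s \<ge> 0" for s
    proof -
      have "fr (x t) + X t \<bullet> (x s - x t) \<le> fr (x s)" "gr (y t) + Y t \<bullet> (y s - y t) \<le> gr (y s)"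
        using reg traj_finite[OF that] by (auto simp: regular_def intro!: subdifferential_real)
      then show ?thesis
        unfolding m_def E by linarith
    qed
  qed (use raw eq in simp)
qed

lemma AC_real_energy:
  assumes "T \<ge> 0"
  shows "abs_continuous_on_interval 0 T (real_energy u v)"
proof -
  have const: "abs_continuous_on_interval 0 T (\<lambda>_. c)" for c :: "'c::real_normed_vector"
    by (rule AC_Lipschitz[of _ _ _ 0]) simp
  have xu: "abs_continuous_on_interval 0 T (\<lambda>t. x t + (- u))"
    by (intro AC_add const AC_traj assms)
  have yv: "abs_continuous_on_interval 0 T (\<lambda>t. y t + (- v))"
    by (intro AC_add const AC_traj assms)
  have nx: "abs_continuous_on_interval 0 T (\<lambda>t. (x t + (- u)) \<bullet> (x t + (- u)))"
    by (intro AC_bilinear[OF bounded_bilinear_inner] xu)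
  have ny: "abs_continuous_on_interval 0 T (\<lambda>t. (y t + (- v)) \<bullet> (y t + (- v)))"
    by (intro AC_bilinear[OF bounded_bilinear_inner] yv)
  have "abs_continuous_on_interval 0 T (\<lambda>t. fr (x t) + (- fr u)
     + (x t + (- u)) \<bullet> adjoint A v + (gr (y t) + (- gr v) + (y t + (- v)) \<bullet> (- A u))
     + D t * (\<alpha>0 / (2 * \<beta>0) * ((x t + (- u)) \<bullet> (x t + (- u)))
        + \<delta>0 / (2 * \<beta>0) * ((y t + (- v)) \<bullet> (y t + (- v)))))"
    by (intro AC_add AC_bilinear[OF bounded_bilinear_mult] AC_bilinear[OF bounded_bilinear_inner]
        const xu yv nx ny AC_traj AC_D assms)
  also have "(\<lambda>t. fr (x t) + (- fr u)
     + (x t + (- u)) \<bullet> adjoint A v + (gr (y t) + (- gr v) + (y t + (- v)) \<bullet> (- A u))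
     + D t * (\<alpha>0 / (2 * \<beta>0) * ((x t + (- u)) \<bullet> (x t + (- u)))
        + \<delta>0 / (2 * \<beta>0) * ((y t + (- v)) \<bullet> (y t + (- v))))) = real_energy u v"
    by (simp add: fun_eq_iff real_energy_def primal_gap_def dual_gap_def power2_norm_eq_inner
        inner_adjoint[OF A] inner_commute[of v])
  finally show ?thesis .
qed

text \<open>The quotient \<open>E / D\<close> is absolutely continuous, and its supporting slope is
  \<open>- (\<alpha> |x'|\<^sup>2 + \<delta> |y'|\<^sup>2 + d / \<beta>) / D \<le> 0\<close> almost everywhere.\<close>

lemma real_energy_decay:
  assumes t: "t \<ge> 0" and uv: "finite_at u v"
  shows "real_energy u v t \<le> real_energy u v 0 * D t"
proof -
  have "real_energy u v t * (1 / D t) \<le> real_energy u v 0 * (1 / D 0)"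
  proof (rule AC_nonincreasing[OF _ t])
    show "abs_continuous_on_interval 0 t (\<lambda>t. real_energy u v t * (1 / D t))"
      by (intro AC_bilinear[OF bounded_bilinear_mult] AC_real_energy AC_inverse_D t)
    show "AE s in lebesgue. 0 < s \<and> s \<le> t \<longrightarrow>
      (\<exists>c\<le>0. left_supporting_slope (\<lambda>t. real_energy u v t * (1 / D t)) 0 s c)"
      using regular_AE
    proof (eventually_elim, intro impI)
      fix s assume "0 < s \<longrightarrow> regular s" and s: "0 < s \<and> s \<le> t"
      then have reg: "regular s" by simp
      define h where "h = \<alpha> s * (norm (x' s))\<^sup>2 + \<delta> s * (norm (y' s))\<^sup>2 + real_bregman u v s / \<beta> s"
      have "h \<ge> 0"
        using \<alpha>_pos[of s] \<delta>_pos[of s] \<beta>_pos[of s] bregman_nonneg[OF reg uv] s by (simp add: h_def)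
      obtain m where m: "(m has_real_derivative - h - real_energy u v s / \<beta> s) (at s)"
        "m s = real_energy u v s" "\<And>r. r \<ge> 0 \<Longrightarrow> m r \<le> real_energy u v r"
        using real_energy_supporting[OF _ reg uv] s by (auto simp: h_def algebra_simps)
      have "left_supporting_slope (\<lambda>t. real_energy u v t * (1 / D t)) 0 s (- h / D s)"
        unfolding left_supporting_slope_def
      proof (intro exI[of _ "\<lambda>r. m r * (1 / D r)"] conjI ballI)
        show "((\<lambda>r. m r * (1 / D r)) has_real_derivative - h / D s) (at s)"
          using m(1,2) D_deriv[of s] D_pos[of s] \<beta>_pos[of s] s
          by (auto intro!: derivative_eq_intros simp: field_simps)
        show "m r * (1 / D r) \<le> real_energy u v r * (1 / D r)" if "r \<in> {0..s}" for r
          using m(3)[of r] that D_pos[of r] by (intro mult_right_mono) auto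
      qed (simp add: m)
      moreover have "- h / D s \<le> 0"
        using \<open>h \<ge> 0\<close> D_pos[of s] by (simp add: divide_nonpos_pos)
      ultimately show "\<exists>c\<le>0. left_supporting_slope (\<lambda>t. real_energy u v t * (1 / D t)) 0 s c"
        by blast
    qed
  qed
  then show ?thesis
    using D_pos[of t] by (simp add: D_0 field_simps)
qed

end

context primal_dual_flow
begin

subsection \<open>Integrability\<close>

lemma x_cont: "continuous_on {0..} x" and y_cont: "continuous_on {0..} y"
  and fx_cont: "continuous_on {0..} (\<lambda>t. fr (x t))" and gy_cont: "continuous_on {0..} (\<lambda>t. gr (y t))"
  by (rule continuous_on_half_line, simp add: AC_traj)+

lemma D_cont: "continuous_on {0..} D"
  by (rule continuous_on_half_line) (rule AC_D)

lemma \<alpha>_cont: "continuous_on {0..} \<alpha>" and \<delta>_cont: "continuous_on {0..} \<delta>"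
proof -
  have "continuous_on {0..} (\<lambda>t. \<alpha>0 / \<beta>0 * \<beta> t * D t)"
    by (intro continuous_intros \<beta>_cont D_cont)
  then show "continuous_on {0..} \<alpha>"
    by (rule continuous_on_eq) (simp add: \<alpha>)
  have "continuous_on {0..} (\<lambda>t. \<delta>0 / \<beta>0 * \<beta> t * D t)"
    by (intro continuous_intros \<beta>_cont D_cont)
  then show "continuous_on {0..} \<delta>"
    by (rule continuous_on_eq) (simp add: \<delta>)
qed

lemma quotient_tendsto:
  assumes "regular t"
  shows "(\<lambda>n. real (Suc n) *\<^sub>R (x (t + 1 / real (Suc n)) - x t)) \<longlonglongrightarrow> x' t"
    and "(\<lambda>n. real (Suc n) *\<^sub>R (y (t + 1 / real (Suc n)) - y t)) \<longlonglongrightarrow> y' t"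
  using assms unfolding regular_def by (simp_all only: difference_quotient_tendsto)

lemma quotient_continuous:
  shows "continuous_on {0<..} (\<lambda>t. real (Suc n) *\<^sub>R (x (t + 1 / real (Suc n)) - x t))"
    and "continuous_on {0<..} (\<lambda>t. real (Suc n) *\<^sub>R (y (t + 1 / real (Suc n)) - y t))"
  by (rule difference_quotient_continuous[OF x_cont] difference_quotient_continuous[OF y_cont], simp)+

lemma continuous_on_positive:
  "continuous_on {0..} h \<Longrightarrow> continuous_on {0<..} h" for h :: "real \<Rightarrow> 'c::topological_space"
  by (rule continuous_on_subset) auto

lemma kinetic_measurable:
  shows "set_borel_measurable lebesgue {0<..} (\<lambda>t. \<alpha> t * (norm (x' t))\<^sup>2)"
    and "set_borel_measurable lebesgue {0<..} (\<lambda>t. \<delta> t * (norm (y' t))\<^sup>2)"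
proof -
  show "set_borel_measurable lebesgue {0<..} (\<lambda>t. \<alpha> t * (norm (x' t))\<^sup>2)"
  proof (rule set_borel_measurable_AE_limit)
    show "continuous_on {0<..}
        (\<lambda>t. \<alpha> t * (norm (real (Suc n) *\<^sub>R (x (t + 1 / real (Suc n)) - x t)))\<^sup>2)" for n
      by (intro continuous_on_mult continuous_on_power continuous_on_norm quotient_continuous
          continuous_on_positive \<alpha>_cont)
    show "AE t in lebesgue. t > 0 \<longrightarrow>
        (\<lambda>n. \<alpha> t * (norm (real (Suc n) *\<^sub>R (x (t + 1 / real (Suc n)) - x t)))\<^sup>2)
          \<longlonglongrightarrow> \<alpha> t * (norm (x' t))\<^sup>2"
      using regular_AE
      by eventually_elim (intro impI tendsto_mult tendsto_const tendsto_power tendsto_norm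
          quotient_tendsto, simp)
  qed
  show "set_borel_measurable lebesgue {0<..} (\<lambda>t. \<delta> t * (norm (y' t))\<^sup>2)"
  proof (rule set_borel_measurable_AE_limit)
    show "continuous_on {0<..}
        (\<lambda>t. \<delta> t * (norm (real (Suc n) *\<^sub>R (y (t + 1 / real (Suc n)) - y t)))\<^sup>2)" for n
      by (intro continuous_on_mult continuous_on_power continuous_on_norm quotient_continuous
          continuous_on_positive \<delta>_cont)
    show "AE t in lebesgue. t > 0 \<longrightarrow>
        (\<lambda>n. \<delta> t * (norm (real (Suc n) *\<^sub>R (y (t + 1 / real (Suc n)) - y t)))\<^sup>2)
          \<longlonglongrightarrow> \<delta> t * (norm (y' t))\<^sup>2"
      using regular_AE
      by eventually_elim (intro impI tendsto_mult tendsto_const tendsto_power tendsto_norm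
          quotient_tendsto, simp)
  qed
qed

lemma bregman_measurable:
  "set_borel_measurable lebesgue {0<..} (\<lambda>t. 1 / \<beta> t * real_bregman u v t)"
proof (rule set_borel_measurable_AE_limit)
  \<comment> \<open>\<open>F\<close> is the Bregman term with the velocities as arguments \<open>a\<close> and \<open>b\<close>. The map
    \<^term>\<open>A\<close> is moved off the velocities so that only inner products of them occur.\<close>
  define F where "F = (\<lambda>t a b. 1 / \<beta> t *
     ((fr u - fr (x t) + \<alpha> t * (a \<bullet> (u - x t)) + \<beta> t * (b \<bullet> A (u - x t)) + y t \<bullet> A (u - x t))
      + (gr v - gr (y t) - \<beta> t * (a \<bullet> adjoint A (v - y t)) + \<delta> t * (b \<bullet> (v - y t)) - x t \<bullet> adjoint A (v - y t))))"
  note positive_cont = inverse_\<beta>_cont[THEN continuous_on_positive] fx_cont[THEN continuous_on_positive]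
    gy_cont[THEN continuous_on_positive] x_cont[THEN continuous_on_positive]
    y_cont[THEN continuous_on_positive] \<alpha>_cont[THEN continuous_on_positive]
    \<beta>_cont[THEN continuous_on_positive] \<delta>_cont[THEN continuous_on_positive]
  have adj: "continuous_on {0<..} (\<lambda>t. a t \<bullet> adjoint A (v - y t))" if "continuous_on {0<..} a" for a
    unfolding inner_adjoint[OF A]
    by (intro continuous_on_inner bounded_linear.continuous_on[OF A that] continuous_on_diff
        continuous_on_const positive_cont)
  show "continuous_on {0<..} (\<lambda>t. F t (real (Suc n) *\<^sub>R (x (t + 1 / real (Suc n)) - x t))
      (real (Suc n) *\<^sub>R (y (t + 1 / real (Suc n)) - y t)))" for n
  proof -
    have Au: "continuous_on {0<..} (\<lambda>t. A (u - x t))"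
      by (intro bounded_linear.continuous_on[OF A] continuous_on_diff continuous_on_const
          positive_cont)
    show ?thesis
      unfolding F_def
      by (intro continuous_on_mult continuous_on_add continuous_on_diff continuous_on_inner
          continuous_on_const positive_cont quotient_continuous Au adj)
  qed
  show "AE t in lebesgue. t > 0 \<longrightarrow> (\<lambda>n. F t (real (Suc n) *\<^sub>R (x (t + 1 / real (Suc n)) - x t))
      (real (Suc n) *\<^sub>R (y (t + 1 / real (Suc n)) - y t))) \<longlonglongrightarrow> 1 / \<beta> t * real_bregman u v t"
    using regular_AE
  proof (eventually_elim, intro impI)
    fix t :: real assume "t > 0 \<longrightarrow> regular t" and t: "t > 0"
    then have "regular t" by simp
    then have "(\<lambda>n. F t (real (Suc n) *\<^sub>R (x (t + 1 / real (Suc n)) - x t))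
      (real (Suc n) *\<^sub>R (y (t + 1 / real (Suc n)) - y t))) \<longlonglongrightarrow> F t (x' t) (y' t)"
      unfolding F_def
      by (intro tendsto_mult tendsto_add tendsto_diff tendsto_inner tendsto_const quotient_tendsto)
    also have "F t (x' t) (y' t) = 1 / \<beta> t * real_bregman u v t"
      using t by (simp add: F_def real_bregman_def X_inner Y_inner inner_adjoint[OF A])
    finally show "(\<lambda>n. F t (real (Suc n) *\<^sub>R (x (t + 1 / real (Suc n)) - x t))
      (real (Suc n) *\<^sub>R (y (t + 1 / real (Suc n)) - y t))) \<longlonglongrightarrow> 1 / \<beta> t * real_bregman u v t" .
  qed
qed

end

locale primal_dual_flow_solution = primal_dual_flow +
  fixes xb :: 'a and yb :: 'b
  assumes sol: "(xb, yb) \<in> primal_dual_solutions f g A"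
begin

lemma sol_subgradients: "- adjoint A yb \<in> subdifferential f xb" "A xb \<in> subdifferential gc yb"
  using sol by (simp_all add: primal_dual_solutions_def)

lemma sol_finite: "finite_at xb yb"
  using subdifferentialD(1)[OF sol_subgradients(1)] subdifferentialD(1)[OF sol_subgradients(2)]
  by (simp add: finite_at_def)

abbreviation E :: "real \<Rightarrow> real" where "E \<equiv> real_energy xb yb"

lemma gaps_nonneg:
  assumes "t \<ge> 0"
  shows "0 \<le> primal_gap xb yb t" "0 \<le> dual_gap xb yb t"
proof -
  show "0 \<le> primal_gap xb yb t"
    using subdifferential_real[OF sol_subgradients(1) traj_finite(1)[OF assms]]
    by (simp add: primal_gap_def inner_minus_left adjoint_inner)
  show "0 \<le> dual_gap xb yb t"
    using subdifferential_real[OF sol_subgradients(2) traj_finite(2)[OF assms]]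
    by (simp add: dual_gap_def inner_commute)
qed

lemma quadratic_nonneg:
  "0 \<le> \<alpha>0 / (2 * \<beta>0) * (norm (x t - xb))\<^sup>2 + \<delta>0 / (2 * \<beta>0) * (norm (y t - yb))\<^sup>2"
  using pos \<beta>0 by simp

lemma E_nonneg: "t \<ge> 0 \<Longrightarrow> 0 \<le> E t"
  using gaps_nonneg[of t] quadratic_nonneg[of t] D_pos[of t] by (simp add: real_energy_def)

lemma gaps_decay:
  assumes "t \<ge> 0"
  shows "primal_gap xb yb t \<le> E 0 * D t" "dual_gap xb yb t \<le> E 0 * D t"
proof -
  have "primal_gap xb yb t + dual_gap xb yb t \<le> E t"
    using quadratic_nonneg[of t] D_pos[of t] by (simp add: real_energy_def)
  with real_energy_decay[OF assms sol_finite] gaps_nonneg[OF assms]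
  show "primal_gap xb yb t \<le> E 0 * D t" "dual_gap xb yb t \<le> E 0 * D t"
    by linarith+
qed

lemma trajectory_bound:
  assumes "t \<ge> 0"
  shows "\<alpha>0 / 2 * (norm (x t - xb))\<^sup>2 + \<delta>0 / 2 * (norm (y t - yb))\<^sup>2 \<le> \<beta>0 * E 0"
proof -
  let ?Q = "\<alpha>0 / (2 * \<beta>0) * (norm (x t - xb))\<^sup>2 + \<delta>0 / (2 * \<beta>0) * (norm (y t - yb))\<^sup>2"
  have "D t * ?Q \<le> D t * E 0"
    using real_energy_decay[OF assms sol_finite] gaps_nonneg[OF assms]
    by (simp add: real_energy_def mult.commute)
  then have "\<beta>0 * ?Q \<le> \<beta>0 * E 0"
    using D_pos[of t] \<beta>0 by (simp add: mult_le_cancel_left_pos)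
  also have "\<beta>0 * ?Q = \<alpha>0 / 2 * (norm (x t - xb))\<^sup>2 + \<delta>0 / 2 * (norm (y t - yb))\<^sup>2"
    using \<beta>0 by (simp add: distrib_left)
  finally show ?thesis .
qed

lemma trajectory_bounded: "bounded ((\<lambda>t. (x t, y t)) ` {0..})"
proof -
  have "x t \<in> cball xb (sqrt (2 / \<alpha>0 * (\<beta>0 * E 0)))" "y t \<in> cball yb (sqrt (2 / \<delta>0 * (\<beta>0 * E 0)))"
    if "t \<ge> 0" for t
  proof -
    have "0 \<le> \<alpha>0 / 2 * (norm (x t - xb))\<^sup>2" "0 \<le> \<delta>0 / 2 * (norm (y t - yb))\<^sup>2"
      using pos by simp_all
    with trajectory_bound[OF that]
    have "\<alpha>0 / 2 * (norm (x t - xb))\<^sup>2 \<le> \<beta>0 * E 0" "\<delta>0 / 2 * (norm (y t - yb))\<^sup>2 \<le> \<beta>0 * E 0"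
      by linarith+
    then have "(norm (x t - xb))\<^sup>2 \<le> 2 / \<alpha>0 * (\<beta>0 * E 0)" "(norm (y t - yb))\<^sup>2 \<le> 2 / \<delta>0 * (\<beta>0 * E 0)"
      using pos by (simp_all add: field_simps)
    then show "x t \<in> cball xb (sqrt (2 / \<alpha>0 * (\<beta>0 * E 0)))" "y t \<in> cball yb (sqrt (2 / \<delta>0 * (\<beta>0 * E 0)))"
      by (simp_all only: mem_cball dist_norm norm_minus_commute[of xb] norm_minus_commute[of yb] real_le_rsqrt)
  qed
  then have "(\<lambda>t. (x t, y t)) ` {0..} \<subseteq> cball xb (sqrt (2 / \<alpha>0 * (\<beta>0 * E 0))) \<times> cball yb (sqrt (2 / \<delta>0 * (\<beta>0 * E 0)))"
    by auto
  then show ?thesis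
    by (rule bounded_subset[rotated]) (intro bounded_Times bounded_cball)
qed

lemma E_slope:
  "AE t in lebesgue. t > 0 \<longrightarrow> left_supporting_slope E 0 t
     (- \<alpha> t * (norm (x' t))\<^sup>2 - \<delta> t * (norm (y' t))\<^sup>2 - real_bregman xb yb t / \<beta> t - E t / \<beta> t)"
  using regular_AE
proof (eventually_elim, intro impI)
  fix t :: real assume "t > 0 \<longrightarrow> regular t" "t > 0"
  then obtain m where "(m has_real_derivative - \<alpha> t * (norm (x' t))\<^sup>2 - \<delta> t * (norm (y' t))\<^sup>2
        - real_bregman xb yb t / \<beta> t - E t / \<beta> t) (at t)"
    "m t = E t" "\<And>s. s \<ge> 0 \<Longrightarrow> m s \<le> E s"
    using real_energy_supporting[OF _ _ sol_finite] by metis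
  then show "left_supporting_slope E 0 t
     (- \<alpha> t * (norm (x' t))\<^sup>2 - \<delta> t * (norm (y' t))\<^sup>2 - real_bregman xb yb t / \<beta> t - E t / \<beta> t)"
    unfolding left_supporting_slope_def by (intro exI[of _ m]) auto
qed

text \<open>For a solution \<open>(xb, yb)\<close> the energy itself is nonnegative, so the term \<open>- E / \<beta>\<close> of the
  dissipation identity has a sign, too.\<close>

lemma E_nonincreasing:
  assumes "0 \<le> s" "s \<le> t"
  shows "E t \<le> E s"
proof (rule AC_nonincreasing[OF _ assms(2)])
  show "abs_continuous_on_interval s t E"
    using AC_subinterval[OF AC_real_energy[of t], of s t] assms by simp
  show "AE r in lebesgue. s < r \<and> r \<le> t \<longrightarrow> (\<exists>c\<le>0. left_supporting_slope E s r c)"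
    using E_slope regular_AE
  proof (eventually_elim, intro impI)
    fix r :: real
    assume slope: "r > 0 \<longrightarrow> left_supporting_slope E 0 r
       (- \<alpha> r * (norm (x' r))\<^sup>2 - \<delta> r * (norm (y' r))\<^sup>2 - real_bregman xb yb r / \<beta> r - E r / \<beta> r)"
      and reg: "r > 0 \<longrightarrow> regular r" and r: "s < r \<and> r \<le> t"
    have "r > 0" using r assms(1) by simp
    have "- \<alpha> r * (norm (x' r))\<^sup>2 - \<delta> r * (norm (y' r))\<^sup>2 - real_bregman xb yb r / \<beta> r - E r / \<beta> r \<le> 0"
    proof -
      have "0 \<le> \<alpha> r * (norm (x' r))\<^sup>2" "0 \<le> \<delta> r * (norm (y' r))\<^sup>2" "0 \<le> real_bregman xb yb r / \<beta> r"
        "0 \<le> E r / \<beta> r"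
        using \<alpha>_pos[of r] \<delta>_pos[of r] \<beta>_pos[of r] bregman_nonneg[OF _ sol_finite] reg E_nonneg[of r]
          \<open>r > 0\<close> by simp_all
      then show ?thesis by simp
    qed
    moreover have "left_supporting_slope E s r c" if "left_supporting_slope E 0 r c" for c
      using that assms(1) unfolding left_supporting_slope_def by fastforce
    ultimately show "\<exists>c\<le>0. left_supporting_slope E s r c"
      using slope \<open>r > 0\<close> by blast
  qed
qed

text \<open>Any part \<open>h\<close> of the dissipation rate is integrable, since the energy, which is bounded below,
  has to pay for it. The statement is generic in \<open>h\<close> to serve the three terms alike.\<close>

lemma dissipation_integrable:
  assumes meas: "set_borel_measurable lebesgue {0<..} h"
    and h: "\<And>t. t > 0 \<Longrightarrow> regular t \<Longrightarrow> 0 \<le> h t"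
    and le: "\<And>t. t > 0 \<Longrightarrow> regular t \<Longrightarrow>
      h t \<le> \<alpha> t * (norm (x' t))\<^sup>2 + \<delta> t * (norm (y' t))\<^sup>2 + 1 / \<beta> t * real_bregman xb yb t"
  shows "set_integrable lebesgue {0<..} h"
proof (rule supporting_slope_integrable[OF _ E_nonincreasing E_nonneg meas])
  show "continuous_on {0..} E"
    by (rule continuous_on_half_line) (rule AC_real_energy)
  show "AE t in lebesgue. t > 0 \<longrightarrow> 0 \<le> h t"
    using regular_AE by eventually_elim (auto intro: h)
  show "AE t in lebesgue. t > 0 \<longrightarrow> (\<exists>c \<le> - h t. left_supporting_slope E 0 t c)"
    using E_slope regular_AE
  proof (eventually_elim, intro impI)
    fix t :: real
    assume slope: "t > 0 \<longrightarrow> left_supporting_slope E 0 t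
       (- \<alpha> t * (norm (x' t))\<^sup>2 - \<delta> t * (norm (y' t))\<^sup>2 - real_bregman xb yb t / \<beta> t - E t / \<beta> t)"
      and reg: "t > 0 \<longrightarrow> regular t" and t: "t > 0"
    have "0 \<le> E t / \<beta> t" using E_nonneg[of t] \<beta>_pos[of t] t by simp
    then have "- \<alpha> t * (norm (x' t))\<^sup>2 - \<delta> t * (norm (y' t))\<^sup>2 - real_bregman xb yb t / \<beta> t - E t / \<beta> t \<le> - h t"
      using le[of t] reg t by simp
    with slope t show "\<exists>c \<le> - h t. left_supporting_slope E 0 t c" by blast
  qed
qed

lemma dissipation_terms_nonneg:
  assumes "t > 0" "regular t"
  shows "0 \<le> \<alpha> t * (norm (x' t))\<^sup>2" "0 \<le> \<delta> t * (norm (y' t))\<^sup>2" "0 \<le> 1 / \<beta> t * real_bregman xb yb t"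
  using assms \<alpha>_pos[of t] \<delta>_pos[of t] \<beta>_pos[of t] bregman_nonneg[OF assms(2) sol_finite] by simp_all

lemma integrability:
  shows "set_integrable lebesgue {0<..} (\<lambda>t. \<alpha> t * (norm (x' t))\<^sup>2)"
    and "set_integrable lebesgue {0<..} (\<lambda>t. \<delta> t * (norm (y' t))\<^sup>2)"
    and "set_integrable lebesgue {0<..} (\<lambda>t. 1 / \<beta> t * real_bregman xb yb t)"
proof -
  show "set_integrable lebesgue {0<..} (\<lambda>t. \<alpha> t * (norm (x' t))\<^sup>2)"
  proof (rule dissipation_integrable[OF kinetic_measurable(1)])
    fix t assume "t > 0" "regular t"
    note nonneg = dissipation_terms_nonneg[OF this]
    then show "0 \<le> \<alpha> t * (norm (x' t))\<^sup>2" by simp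
    from nonneg show "\<alpha> t * (norm (x' t))\<^sup>2
        \<le> \<alpha> t * (norm (x' t))\<^sup>2 + \<delta> t * (norm (y' t))\<^sup>2 + 1 / \<beta> t * real_bregman xb yb t"
      by linarith
  qed
  show "set_integrable lebesgue {0<..} (\<lambda>t. \<delta> t * (norm (y' t))\<^sup>2)"
  proof (rule dissipation_integrable[OF kinetic_measurable(2)])
    fix t assume "t > 0" "regular t"
    note nonneg = dissipation_terms_nonneg[OF this]
    then show "0 \<le> \<delta> t * (norm (y' t))\<^sup>2" by simp
    from nonneg show "\<delta> t * (norm (y' t))\<^sup>2
        \<le> \<alpha> t * (norm (x' t))\<^sup>2 + \<delta> t * (norm (y' t))\<^sup>2 + 1 / \<beta> t * real_bregman xb yb t"
      by linarith
  qed
  show "set_integrable lebesgue {0<..} (\<lambda>t. 1 / \<beta> t * real_bregman xb yb t)"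
  proof (rule dissipation_integrable[OF bregman_measurable])
    fix t assume "t > 0" "regular t"
    note nonneg = dissipation_terms_nonneg[OF this]
    then show "0 \<le> 1 / \<beta> t * real_bregman xb yb t" by simp
    from nonneg show "1 / \<beta> t * real_bregman xb yb t
        \<le> \<alpha> t * (norm (x' t))\<^sup>2 + \<delta> t * (norm (y' t))\<^sup>2 + 1 / \<beta> t * real_bregman xb yb t"
      by linarith
  qed
qed

subsection \<open>Weak limit points\<close>

lemma traj_le_real:
  "t \<ge> 0 \<Longrightarrow> f (x t) \<le> ereal (fr (x t))" "t \<ge> 0 \<Longrightarrow> gc (y t) \<le> ereal (gr (y t))"
  using traj_finite[of t] by (simp_all add: ereal_real)

text \<open>Along \<open>\<tau>\<close> both parts of the gap for \<open>(xb, yb)\<close> tend to 0, which identifies the limits of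
  \<open>f (x (\<tau> k))\<close> and of the conjugate at \<open>y (\<tau> k)\<close>. With weak lower semicontinuity, the decay of
  the gap for all \<open>(u, v)\<close> makes \<open>(p, q)\<close> a saddle point of the Lagrangian. The choices
  \<open>v = q\<close> and \<open>u = p\<close> are the two subgradient inclusions.\<close>

lemma weak_limit_solution:
  assumes f: "ereal_convex f" "lower_semicontinuous f"
    and D0: "(D \<longlongrightarrow> 0) at_top" and \<tau>: "filterlim \<tau> at_top sequentially"
    and wx: "weakly_converges (\<lambda>k. x (\<tau> k)) p" and wy: "weakly_converges (\<lambda>k. y (\<tau> k)) q"
  shows "(p, q) \<in> primal_dual_solutions f g A"
proof -
  have ev: "\<forall>\<^sub>F k in sequentially. \<tau> k \<ge> 0"
    using \<tau> by (simp add: filterlim_at_top)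
  have D\<tau>: "(\<lambda>k. c * D (\<tau> k)) \<longlonglongrightarrow> 0" for c
    using tendsto_mult_right_zero[OF filterlim_compose[OF D0 \<tau>]] .
  have x_lim: "(\<lambda>k. x (\<tau> k) \<bullet> h) \<longlonglongrightarrow> p \<bullet> h" for h
    using wx by (simp add: weakly_converges_def)
  have y_lim: "(\<lambda>k. y (\<tau> k) \<bullet> h) \<longlonglongrightarrow> q \<bullet> h" for h
    using wy by (simp add: weakly_converges_def)
  have vA_lim: "(\<lambda>k. v \<bullet> A (x (\<tau> k))) \<longlonglongrightarrow> v \<bullet> A p" for v
    using x_lim[of "adjoint A v"] unfolding inner_adjoint[OF A] by (simp add: inner_commute)
  have primal_lim: "(\<lambda>k. primal_gap xb yb (\<tau> k)) \<longlonglongrightarrow> 0"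
    by (rule tendsto_sandwich[OF _ _ tendsto_const D\<tau>[of "E 0"]])
      (use ev in \<open>auto elim!: eventually_mono intro: gaps_nonneg gaps_decay\<close>)
  have dual_lim: "(\<lambda>k. dual_gap xb yb (\<tau> k)) \<longlonglongrightarrow> 0"
    by (rule tendsto_sandwich[OF _ _ tendsto_const D\<tau>[of "E 0"]])
      (use ev in \<open>auto elim!: eventually_mono intro: gaps_nonneg gaps_decay\<close>)
  \<comment> \<open>The limits of \<open>f (x (\<tau> k))\<close> and of the conjugate at \<open>y (\<tau> k)\<close>.\<close>
  define a where "a = fr xb - (yb \<bullet> A p - yb \<bullet> A xb)"
  define b where "b = gr yb + (q \<bullet> A xb - yb \<bullet> A xb)"
  have f_lim: "(\<lambda>k. fr (x (\<tau> k))) \<longlonglongrightarrow> a"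
  proof -
    have "(\<lambda>k. primal_gap xb yb (\<tau> k) + fr xb - (yb \<bullet> A (x (\<tau> k)) - yb \<bullet> A xb))
        \<longlonglongrightarrow> 0 + fr xb - (yb \<bullet> A p - yb \<bullet> A xb)"
      by (intro tendsto_add tendsto_diff tendsto_const primal_lim vA_lim)
    then show ?thesis by (simp add: primal_gap_def a_def A_simps inner_simps)
  qed
  have g_lim: "(\<lambda>k. gr (y (\<tau> k))) \<longlonglongrightarrow> b"
  proof -
    have "(\<lambda>k. dual_gap xb yb (\<tau> k) + gr yb + (y (\<tau> k) \<bullet> A xb - yb \<bullet> A xb))
        \<longlonglongrightarrow> 0 + gr yb + (q \<bullet> A xb - yb \<bullet> A xb)"
      by (intro tendsto_add tendsto_diff tendsto_const dual_lim y_lim)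
    then show ?thesis by (simp add: dual_gap_def b_def inner_simps)
  qed
  have "f p \<le> ereal a"
    by (rule weak_lsc[OF f wx _ f_lim])
      (use ev in \<open>auto elim!: eventually_mono intro: traj_le_real\<close>)
  moreover have "f p \<noteq> -\<infinity>" using f_proper by (simp add: proper_def)
  ultimately obtain c where c: "f p = ereal c" "c \<le> a" by (cases "f p") auto
  have "gc q \<le> ereal b"
    by (rule weak_lsc_conjugate[OF wy _ g_lim])
      (use ev in \<open>auto elim!: eventually_mono intro: traj_le_real\<close>)
  moreover have "gc q \<noteq> -\<infinity>" by (rule fenchel_conjugate_gt_MInf[OF g_proper])
  ultimately obtain e where e: "gc q = ereal e" "e \<le> b" by (cases "gc q") auto
  have gap: "c - fr u + v \<bullet> A (p - u) + (e - gr v - (q - v) \<bullet> A u) \<le> 0" if uv: "finite_at u v" for u v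
  proof -
    have "(\<lambda>k. (fr (x (\<tau> k)) - fr u + (v \<bullet> A (x (\<tau> k)) - v \<bullet> A u))
          + (gr (y (\<tau> k)) - gr v - (y (\<tau> k) \<bullet> A u - v \<bullet> A u)))
        \<longlonglongrightarrow> (a - fr u + (v \<bullet> A p - v \<bullet> A u)) + (b - gr v - (q \<bullet> A u - v \<bullet> A u))"
      by (intro tendsto_add tendsto_diff tendsto_const f_lim g_lim vA_lim y_lim)
    moreover have "\<forall>\<^sub>F k in sequentially. (fr (x (\<tau> k)) - fr u + (v \<bullet> A (x (\<tau> k)) - v \<bullet> A u))
          + (gr (y (\<tau> k)) - gr v - (y (\<tau> k) \<bullet> A u - v \<bullet> A u)) \<le> real_energy u v 0 * D (\<tau> k)"
      using ev
    proof eventually_elim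
      case (elim k)
      have "0 \<le> D (\<tau> k) * (\<alpha>0 / (2 * \<beta>0) * (norm (x (\<tau> k) - u))\<^sup>2 + \<delta>0 / (2 * \<beta>0) * (norm (y (\<tau> k) - v))\<^sup>2)"
        using D_pos[of "\<tau> k"] pos \<beta>0 by simp
      with real_energy_decay[OF elim uv] show ?case
        by (simp add: real_energy_def primal_gap_def dual_gap_def A_simps inner_simps)
    qed
    ultimately have "(a - fr u + (v \<bullet> A p - v \<bullet> A u)) + (b - gr v - (q \<bullet> A u - v \<bullet> A u)) \<le> 0"
      by (rule tendsto_le[OF sequentially_bot D\<tau>[of "real_energy u v 0"]])
    then show ?thesis using c e by (simp add: A_simps inner_simps)
  qed
  have "- adjoint A q \<in> subdifferential f p"
    unfolding subdifferential_def
  proof (intro CollectI conjI allI)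
    fix w
    have w: "f w \<noteq> -\<infinity>" using f_proper by (simp add: proper_def)
    show "f p + ereal (- adjoint A q \<bullet> (w - p)) \<le> f w"
    proof (cases "f w")
      case (real r)
      then have "finite_at w q" using e by (simp add: finite_at_def)
      from gap[OF this] real e c show ?thesis
        by (simp add: A_simps inner_simps adjoint_inner)
    qed (use w in auto)
  qed (use c in simp)
  moreover have "A p \<in> subdifferential gc q"
    unfolding subdifferential_def
  proof (intro CollectI conjI allI)
    fix w
    have w: "gc w \<noteq> -\<infinity>" by (rule fenchel_conjugate_gt_MInf[OF g_proper])
    show "gc q + ereal (A p \<bullet> (w - q)) \<le> gc w"
    proof (cases "gc w")
      case (real r)
      then have "finite_at p w" using c by (simp add: finite_at_def)
      from gap[OF this] real e c show ?thesis
        by (simp add: A_simps inner_simps inner_commute)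
    qed (use w in auto)
  qed (use e in simp)
  ultimately show ?thesis
    by (simp add: primal_dual_solutions_def)
qed

subsection \<open>Strong convexity and smoothness\<close>

lemma strongly_convex_bound:
  assumes f: "strongly_convex \<mu> f" and "\<mu> > 0" and t: "t \<ge> 0"
  shows "(norm (x t - xb))\<^sup>2 \<le> 2 / \<mu> * E 0 * D t"
proof -
  have "\<mu> / 2 * (norm (x t - xb))\<^sup>2 \<le> primal_gap xb yb t"
    using strongly_convex_subgradient[OF f sol_subgradients(1) traj_finite(1)[OF t]]
    by (simp add: primal_gap_def inner_minus_left adjoint_inner)
  also have "\<dots> \<le> E 0 * D t" by (rule gaps_decay[OF t])
  finally show ?thesis using \<open>\<mu> > 0\<close> by (simp add: field_simps)
qed

lemma smooth_bound:
  assumes g: "ereal_convex g" "smooth_fun L g" and "L > 0" and t: "t \<ge> 0"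
  shows "(norm (y t - yb))\<^sup>2 \<le> 2 * L * E 0 * D t"
proof -
  have "1 / (2 * L) * (norm (y t - yb))\<^sup>2 \<le> dual_gap xb yb t"
    using smooth_conjugate_subgradient[OF g \<open>L > 0\<close> sol_subgradients(2) traj_finite(2)[OF t]]
    by (simp add: dual_gap_def inner_commute)
  also have "\<dots> \<le> E 0 * D t" by (rule gaps_decay[OF t])
  finally show ?thesis using \<open>L > 0\<close> by (simp add: field_simps)
qed

end

text \<open>Adding the strong monotonicity of the subdifferential of \<open>f\<close> to the monotonicity of that of the
  conjugate makes the coupling terms \<open>q \<bullet> A p\<close> cancel.\<close>

lemma strongly_convex_solution_unique:
  fixes f :: "'a::{real_inner, complete_space} \<Rightarrow> ereal"
  assumes A: "bounded_linear A" and f: "strongly_convex \<mu> f" "\<mu> > 0"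
    and sol: "(p, q) \<in> primal_dual_solutions f g A" "(p', q') \<in> primal_dual_solutions f g A"
  shows "p = p'"
proof -
  have A_diff: "A (r - s) = A r - A s" for r s
    using A by (simp add: bounded_linear.linear linear_diff)
  have adj: "adjoint A w \<bullet> z = w \<bullet> A z" for w z
    using inner_adjoint[OF A, of z w] by (simp add: inner_commute)
  have p: "- adjoint A q \<in> subdifferential f p" "- adjoint A q' \<in> subdifferential f p'"
    and q: "A p \<in> subdifferential (fenchel_conjugate g) q" "A p' \<in> subdifferential (fenchel_conjugate g) q'"
    using sol by (simp_all add: primal_dual_solutions_def)
  note fin = subdifferentialD(1)[OF p(1)] subdifferentialD(1)[OF p(2)]
    subdifferentialD(1)[OF q(1)] subdifferentialD(1)[OF q(2)]
  have "real_of_ereal (f p) - q \<bullet> A (p' - p) + \<mu> / 2 * (norm (p - p'))\<^sup>2 \<le> real_of_ereal (f p')"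
    "real_of_ereal (f p') - q' \<bullet> A (p - p') + \<mu> / 2 * (norm (p - p'))\<^sup>2 \<le> real_of_ereal (f p)"
    using strongly_convex_subgradient[OF f(1) p(1) fin(2)] strongly_convex_subgradient[OF f(1) p(2) fin(1)]
    by (simp_all add: adj norm_minus_commute)
  moreover have "A p \<bullet> (q' - q) + A p' \<bullet> (q - q') \<le> 0"
    using subdifferential_real[OF q(1) fin(4)] subdifferential_real[OF q(2) fin(3)] by linarith
  ultimately have "\<mu> * (norm (p - p'))\<^sup>2 \<le> 0"
    by (simp add: A_diff inner_simps inner_commute)
  then show ?thesis
    using f(2) by (simp add: mult_le_0_iff)
qed

theorem theorem4p3:
  fixes f :: "'a::{real_inner, complete_space} \<Rightarrow> ereal"
    and g :: "'b::{real_inner, complete_space} \<Rightarrow> ereal"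
    and A :: "'a \<Rightarrow> 'b"
    and \<alpha> \<beta> \<gamma> \<delta> :: "real \<Rightarrow> real"
    and \<alpha>0 \<beta>0 \<delta>0 :: real
    and x :: "real \<Rightarrow> 'a" and y :: "real \<Rightarrow> 'b"
    and u xb :: 'a and v yb :: 'b
  defines "\<S> \<equiv> primal_dual_solutions f g A"
    and "\<Delta> \<equiv> duality_gap f g A x y"
    and "\<E> \<equiv> energy f g A \<alpha> \<beta> \<delta> x y"
    and "d \<equiv> bregman f g A \<alpha> \<beta> \<gamma> \<delta> x y"
    and "decay \<equiv> \<lambda>t. exp (- integral {0..t} (\<lambda>s. 1 / \<beta> s))"
  assumes f: "proper f" "ereal_convex f" "lower_semicontinuous f"
    and g: "proper g" "ereal_convex g" "lower_semicontinuous g"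
    and A: "bounded_linear A"
    and \<beta>: "\<And>t. t \<ge> 0 \<Longrightarrow> \<beta> t > 0" "\<beta> differentiable_on {0..}" "\<beta>0 = \<beta> 0"
    and pos: "\<alpha>0 > 0" "\<delta>0 > 0"
    and \<alpha>: "\<And>t. t \<ge> 0 \<Longrightarrow> \<alpha> t = \<alpha>0 / \<beta>0 * \<beta> t * decay t"
    and \<gamma>: "\<And>t. t \<ge> 0 \<Longrightarrow> \<gamma> t = - \<beta> t"
    and \<delta>: "\<And>t. t \<ge> 0 \<Longrightarrow> \<delta> t = \<delta>0 / \<beta>0 * \<beta> t * decay t"
    and traj: "trajectory f g A \<alpha> \<beta> \<gamma> \<delta> x y"
    and sol: "(xb, yb) \<in> \<S>"
  shows "ereal_integrable_half_line (\<lambda>t. ereal (1 / \<beta> t) * d xb yb t)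
    \<and> set_integrable lebesgue {0<..} (\<lambda>t. \<alpha> t * (norm (vector_derivative x (at t)))\<^sup>2)
    \<and> set_integrable lebesgue {0<..} (\<lambda>t. \<delta> t * (norm (vector_derivative y (at t)))\<^sup>2)
    \<and> (\<forall>t\<ge>0. \<Delta> u v t \<le> \<E> u v 0 * ereal (decay t))
    \<and> (\<forall>t\<ge>0. f (x t) - f xb + ereal (adjoint A yb \<bullet> (x t - xb)) \<le> \<E> xb yb 0 * ereal (decay t))
    \<and> (\<forall>t\<ge>0. fenchel_conjugate g (y t) - fenchel_conjugate g yb + ereal ((y t - yb) \<bullet> (- A xb))
          \<le> \<E> xb yb 0 * ereal (decay t))
    \<and> bounded ((\<lambda>t. (x t, y t)) ` {0..})
    \<and> (\<forall>t\<ge>0. ereal (\<alpha>0 / 2 * (norm (x t - xb))\<^sup>2 + \<delta>0 / 2 * (norm (y t - yb))\<^sup>2)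
          \<le> ereal \<beta>0 * \<E> xb yb 0)
    \<and> (filterlim (\<lambda>T. integral {0..T} (\<lambda>s. 1 / \<beta> s)) at_top at_top \<longrightarrow>
        (\<forall>w. weak_subseq_limit (\<lambda>t. (x t, y t)) w \<longrightarrow> w \<in> \<S>))
    \<and> (\<forall>\<mu>>0. strongly_convex \<mu> f \<longrightarrow>
        (filterlim (\<lambda>T. integral {0..T} (\<lambda>s. 1 / \<beta> s)) at_top at_top \<longrightarrow> (x \<longlongrightarrow> xb) at_top)
        \<and> fst ` \<S> = {xb}
        \<and> (\<forall>t\<ge>0. ereal ((norm (x t - xb))\<^sup>2) \<le> ereal (2 / \<mu>) * \<E> xb yb 0 * ereal (decay t)))
    \<and> (\<forall>L>0. smooth_fun L g \<longrightarrow>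
        (\<forall>t\<ge>0. ereal ((norm (y t - yb))\<^sup>2) \<le> ereal (2 * L) * \<E> xb yb 0 * ereal (decay t)))"
proof -
  have cont: "continuous_on {0..} \<beta>"
    using \<beta>(2) by (rule differentiable_imp_continuous_on)
  have \<beta>0_pos: "\<beta>0 > 0" using \<beta>(1)[of 0] \<beta>(3) by simp
  have decay_eq: "decay t = exp (- integral {0..t} (\<lambda>s. 1 / \<beta> s))" for t
    by (simp add: decay_def)
  interpret primal_dual_flow f g A \<alpha> \<beta> \<gamma> \<delta> \<alpha>0 \<beta>0 \<delta>0 x y decay
    by (rule primal_dual_flow.intro; fact)
  interpret primal_dual_flow_solution f g A \<alpha> \<beta> \<gamma> \<delta> \<alpha>0 \<beta>0 \<delta>0 x y decay xb yb
    using sol by unfold_locales (simp add: \<S>_def)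
  have E0: "\<E> xb yb 0 = ereal (E 0)"
    unfolding \<E>_def by (rule energy_eq[OF sol_finite]) simp
  have decay_0: "(decay \<longlongrightarrow> 0) at_top"
    if "filterlim (\<lambda>T. integral {0..T} (\<lambda>s. 1 / \<beta> s)) at_top at_top"
  proof -
    have "filterlim (\<lambda>T. - integral {0..T} (\<lambda>s. 1 / \<beta> s)) at_bot at_top"
      using that by (simp add: filterlim_uminus_at_bot)
    then show ?thesis
      unfolding decay_def by (rule filterlim_compose[OF exp_at_bot])
  qed
  have d: "d xb yb t = ereal (real_bregman xb yb t)" if "t \<ge> 0" for t
    unfolding d_def by (rule bregman_eq[OF sol_finite that])
  have bregman_integrable: "ereal_integrable_half_line (\<lambda>t. ereal (1 / \<beta> t) * d xb yb t)"
    unfolding ereal_integrable_half_line_def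
  proof (intro conjI AE_I2 impI)
    fix t :: real assume "t > 0"
    then show "\<bar>ereal (1 / \<beta> t) * d xb yb t\<bar> \<noteq> \<infinity>" by (simp add: d)
  next
    show "set_integrable lebesgue {0<..} (\<lambda>t. real_of_ereal (ereal (1 / \<beta> t) * d xb yb t))"
      using integrability(3)
      by (rule set_integrable_cong[THEN iffD1, rotated -1]) (auto simp: d)
  qed
  have gap_rate: "\<Delta> u v t \<le> \<E> u v 0 * ereal (decay t)" if t: "t \<ge> 0" for t
  proof (cases "finite_at u v")
    case True
    have "0 \<le> decay t * (\<alpha>0 / (2 * \<beta>0) * (norm (x t - u))\<^sup>2 + \<delta>0 / (2 * \<beta>0) * (norm (y t - v))\<^sup>2)"
      using D_pos[of t] pos \<beta>0 by simp
    then have "primal_gap u v t + dual_gap u v t \<le> real_energy u v t"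
      by (simp add: real_energy_def)
    also have "\<dots> \<le> real_energy u v 0 * decay t"
      by (rule real_energy_decay[OF t True])
    finally show ?thesis
      unfolding \<Delta>_def \<E>_def using duality_gap_eq[OF True t] energy_eq[OF True, of 0] by simp
  next
    case False
    \<comment> \<open>Here the gap is \<open>-\<infinity>\<close>.\<close>
    have "f u \<noteq> -\<infinity>" using f(1) by (simp add: proper_def)
    moreover have "fenchel_conjugate g v \<noteq> -\<infinity>" by (rule fenchel_conjugate_gt_MInf[OF g(1)])
    ultimately have "\<Delta> u v t = -\<infinity>"
      unfolding \<Delta>_def using False
      by (intro duality_gap_eq_MInfty traj_finite t) (auto simp: finite_at_def)
    then show ?thesis by simp
  qed
  have primal_rate: "f (x t) - f xb + ereal (adjoint A yb \<bullet> (x t - xb)) \<le> \<E> xb yb 0 * ereal (decay t)"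
    if t: "t \<ge> 0" for t
  proof -
    obtain a b c e where "f (x t) = ereal a" "f xb = ereal c"
      by (rule finite_values[OF sol_finite t])
    then show ?thesis
      using gaps_decay(1)[OF t] by (simp add: E0 primal_gap_def adjoint_inner)
  qed
  have dual_rate: "fenchel_conjugate g (y t) - fenchel_conjugate g yb + ereal ((y t - yb) \<bullet> (- A xb))
      \<le> \<E> xb yb 0 * ereal (decay t)" if t: "t \<ge> 0" for t
  proof -
    obtain a b c e where "gc (y t) = ereal b" "gc yb = ereal e"
      by (rule finite_values[OF sol_finite t])
    then show ?thesis
      using gaps_decay(2)[OF t] by (simp add: E0 dual_gap_def)
  qed
  have bound: "ereal (\<alpha>0 / 2 * (norm (x t - xb))\<^sup>2 + \<delta>0 / 2 * (norm (y t - yb))\<^sup>2)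
      \<le> ereal \<beta>0 * \<E> xb yb 0" if "t \<ge> 0" for t
    using trajectory_bound[OF that] by (simp add: E0)
  have weak_limits: "w \<in> \<S>"
    if "filterlim (\<lambda>T. integral {0..T} (\<lambda>s. 1 / \<beta> s)) at_top at_top"
      and w: "weak_subseq_limit (\<lambda>t. (x t, y t)) w" for w
  proof -
    from w obtain \<tau> where \<tau>: "filterlim \<tau> at_top sequentially"
      "\<And>h. (\<lambda>k. (x (\<tau> k), y (\<tau> k)) \<bullet> h) \<longlonglongrightarrow> w \<bullet> h"
      by (auto simp: weak_subseq_limit_def weakly_converges_def)
    have "weakly_converges (\<lambda>k. x (\<tau> k)) (fst w)"
      using \<tau>(2)[of "(_, 0)"] by (simp add: weakly_converges_def inner_prod_def)
    moreover have "weakly_converges (\<lambda>k. y (\<tau> k)) (snd w)"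
      using \<tau>(2)[of "(0, _)"] by (simp add: weakly_converges_def inner_prod_def)
    ultimately have "(fst w, snd w) \<in> \<S>"
      unfolding \<S>_def by (rule weak_limit_solution[OF f(2,3) decay_0[OF that(1)] \<tau>(1)])
    then show ?thesis by simp
  qed
  have strong_convergence: "(x \<longlongrightarrow> xb) at_top"
    if \<mu>: "\<mu> > 0" "strongly_convex \<mu> f"
      and infinite: "filterlim (\<lambda>T. integral {0..T} (\<lambda>s. 1 / \<beta> s)) at_top at_top" for \<mu>
  proof -
    have upper: "((\<lambda>t. 2 / \<mu> * E 0 * decay t) \<longlongrightarrow> 0) at_top"
      by (intro tendsto_mult_right_zero decay_0 infinite)
    have "((\<lambda>t. (norm (x t - xb))\<^sup>2) \<longlongrightarrow> 0) at_top"
    proof (rule tendsto_sandwich[OF _ _ tendsto_const upper])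
      show "\<forall>\<^sub>F t in at_top. (norm (x t - xb))\<^sup>2 \<le> 2 / \<mu> * E 0 * decay t"
        using eventually_ge_at_top[of 0] by eventually_elim (rule strongly_convex_bound[OF \<mu>(2,1)])
    qed simp
    then have "((\<lambda>t. sqrt ((norm (x t - xb))\<^sup>2)) \<longlongrightarrow> sqrt 0) at_top"
      by (rule tendsto_real_sqrt)
    then show ?thesis
      by (simp add: tendsto_norm_zero_iff LIM_zero_iff)
  qed
  have unique: "fst ` \<S> = {xb}" if "\<mu> > 0" "strongly_convex \<mu> f" for \<mu>
  proof -
    have "p = xb" if "(p, q) \<in> \<S>" for p q
      using strongly_convex_solution_unique[OF A \<open>strongly_convex \<mu> f\<close> \<open>\<mu> > 0\<close>] that sol
      unfolding \<S>_def by blast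
    moreover have "xb \<in> fst ` \<S>"
      by (rule image_eqI[of _ _ "(xb, yb)"]) (simp_all add: \<S>_def sol)
    ultimately show ?thesis by auto
  qed
  have strong_rate: "ereal ((norm (x t - xb))\<^sup>2) \<le> ereal (2 / \<mu>) * \<E> xb yb 0 * ereal (decay t)"
    if "\<mu> > 0" "strongly_convex \<mu> f" "t \<ge> 0" for \<mu> t
    using strongly_convex_bound[OF that(2,1,3)] by (simp add: E0)
  have smooth_rate: "ereal ((norm (y t - yb))\<^sup>2) \<le> ereal (2 * L) * \<E> xb yb 0 * ereal (decay t)"
    if "L > 0" "smooth_fun L g" "t \<ge> 0" for L t
    using smooth_bound[OF g(2) that(2,1,3)] by (simp add: E0)
  show ?thesis
    by (intro conjI allI impI bregman_integrable integrability(1,2) gap_rate primal_rate dual_rate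
        trajectory_bounded bound weak_limits strong_rate smooth_rate;
      (assumption | (rule strong_convergence unique; assumption)))
qed

end
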